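(* Let $r>0$ and $\kappa<\infty$ be fixed. The least squares model selection procedure $\widehat S^{\kappa}_{\widehat m}$ with ordered variable selection satisfies $$\limsup_{n\to\infty}\ \sup_{\beta>0}\ \mathcal R_n(\widehat S^{\kappa}_{\widehat m},\beta)<\infty .$$
   Context: Model: $dy_t=S(t)\,dt+d\xi_t$, $0\le t\le n$, where $S$ is an unknown $1$-periodic function and the noise $(\xi_t)_{t\ge0}$ is a continuous zero-mean Gaussian process such that $\int_0^nf(t)\,d\xi_t$ is well defined (and linear in $f$) for all non-random $f\in L_2[0,n]$, $n\ge1$. $\mathcal X$ is the Hilbert space of square integrable $1$-periodic functions on $\mathbb R$ with $(x,y)=\int_0^1x(t)y(t)\,dt$ and $\|x\|^2=(x,x)$. $(\phi_j)_{j\ge1}$ is an orthonormal basis of $\mathcal X$. Functional class: for $\beta>0$, $$\Theta_{\beta,r}=\Big\{S\in\mathcal C(\mathbb R)\cap\mathcal X:\ \max_{n\ge1}n^{2\beta}\varsigma_n(S)\le r^2\Big\},\qquad \varsigma_n(S)=\sum_{j=n}^\infty s_j^2,\quad s_j=(S,\phi_j),$$ where $\mathcal C(\mathbb R)$ is the set of continuous functions $\mathbb R\to\mathbb R$. Noise class: $\mathcal P_\kappa$ is some class of distributions $Q$ on $\mathbf C[0,+\infty)$ of the noise process. It contains the Wiener distribution $Q_0$. For every $Q\in\mathcal P_\kappa$: for all $n,k\ge1$ the vector with components $\zeta_j(n)=\frac1{\sqrt n}\int_0^n\phi_j(t)\,d\xi_t$, $1\le j\le k$, is Gaussian with non-degenerate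 covariance matrix $B_{k,n}$, and $\sup_{k\ge1}\sup_{n\ge1}\lambda_{\max}(B_{k,n})\le\lambda^*(Q)\le\kappa$, where $\lambda_{\max}$ is the maximal eigenvalue and $\kappa$ is known. Risk of an estimator $\widetilde S_n$ (a measurable function of $(y_t)_{0\le t\le n}$): $$\mathcal R_n(\widetilde S_n,\beta)=\sup_{S\in\Theta_{\beta,r}}\sup_{Q\in\mathcal P_\kappa}\mathbf E_{S,Q}\|\omega_n(\widetilde S_n-S)\|^2,\qquad \omega_n=n^{\frac{\beta}{2\beta+1}},$$ where $\mathbf E_{S,Q}$ is the expectation under the law of $y$ when the noise has distribution $Q$. Estimator: $\mathcal M=\{m_1,\ldots,m_n\}$ with $m_i=\{1,\ldots,i\}$ (so $d_{m_i}=i$) and $l_m=1$ for all $m$. $\widehat S_m=\sum_{j\in m}\widehat\alpha_j\phi_j$ with $\widehat\alpha_j=\frac1n\int_0^n\phi_j(t)\,dy_t$. $\gamma_n(x)=\|x\|^2-\frac2n\int_0^nx(t)\,dy_t$ (extended by linearity of the integral to finite combinations of the $\phi_j$ with random coefficients). $P_n(m)=4\kappa\frac{z_*^2}{z_*-1}\frac{d_m}{n}$, where $z_*\approx3.1462$ is the maximal root of $\ln z=z-2$. $\widehat m=\operatorname{argmin}_{m\in\mathcal M}\{\gamma_n(\widehat S_m)+P_n(m)\}$, and $\widehat S^\kappa_{\widehat m}=\widehat S_{\widehat m}$. *)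

theory Defs
  imports "HOL-Probability.Probability" "Jordan_Normal_Form.Spectral_Radius"
begin

definition L2_on :: "real \<Rightarrow> (real \<Rightarrow> real) set" where
  "L2_on T = {f. set_borel_measurable lebesgue {0..T} f \<and>
                 set_integrable lebesgue {0..T} (\<lambda>t. (f t)\<^sup>2)}"

definition inner_L2 :: "real \<Rightarrow> (real \<Rightarrow> real) \<Rightarrow> (real \<Rightarrow> real) \<Rightarrow> real" where
  "inner_L2 T f g = (LINT t:{0..T}|lebesgue. f t * g t)"

definition norm_L2 :: "real \<Rightarrow> (real \<Rightarrow> real) \<Rightarrow> real" where
  "norm_L2 T f = sqrt (inner_L2 T f f)"

text \<open>Elements are functions rather than classes modulo null sets.\<close>

definition periodic_L2 :: "(real \<Rightarrow> real) set" where
  "periodic_L2 = {f \<in> L2_on 1. \<forall>t. f (t + 1) = f t}"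

text \<open>Basis functions are indexed from 1; the value at index 0 is irrelevant.\<close>

definition orthonormal_basis :: "(nat \<Rightarrow> real \<Rightarrow> real) \<Rightarrow> bool" where
  "orthonormal_basis \<phi> \<longleftrightarrow>
     (\<forall>j\<ge>1. \<phi> j \<in> periodic_L2) \<and>
     (\<forall>i\<ge>1. \<forall>j\<ge>1. inner_L2 1 (\<phi> i) (\<phi> j) = (if i = j then 1 else 0)) \<and>
     (\<forall>f\<in>periodic_L2. \<forall>\<epsilon>>0. \<exists>N c. norm_L2 1 (\<lambda>t. f t - (\<Sum>j=1..N. c j * \<phi> j t)) < \<epsilon>)"

definition tail_energy :: "(nat \<Rightarrow> real \<Rightarrow> real) \<Rightarrow> (real \<Rightarrow> real) \<Rightarrow> nat \<Rightarrow> real" where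
  "tail_energy \<phi> S n = (\<Sum>i. (inner_L2 1 S (\<phi> (n + i)))\<^sup>2)"

definition Theta :: "(nat \<Rightarrow> real \<Rightarrow> real) \<Rightarrow> real \<Rightarrow> real \<Rightarrow> (real \<Rightarrow> real) set" where
  "Theta \<phi> \<beta> r = {S \<in> periodic_L2. continuous_on UNIV S \<and>
     (\<forall>n\<ge>1. real n powr (2 * \<beta>) * tail_energy \<phi> S n \<le> r\<^sup>2)}"

text \<open>Continuous functions on \<open>[0, \<infinity>)\<close> (extended by \<open>undefined\<close> to negative arguments) with the
  \<open>\<sigma>\<close>-algebra of the coordinate maps, which is the Borel \<open>\<sigma>\<close>-algebra of locally uniform
  convergence. A process is identified with its law here, and \<open>w t\<close> is its value at time \<open>t\<close>.\<close>

definition path_space :: "(real \<Rightarrow> real) measure" where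
  "path_space = restrict_space (PiM {0..} (\<lambda>_. borel)) {w. continuous_on {0..} w}"

definition path_law :: "(real \<Rightarrow> real) measure \<Rightarrow> bool" where
  "path_law M \<longleftrightarrow> prob_space M \<and> sets M = sets path_space"

text \<open>The \<open>\<sigma>\<close>-algebra generated by the path up to time \<open>T\<close>.\<close>

definition history :: "real \<Rightarrow> (real \<Rightarrow> real) measure" where
  "history T = vimage_algebra (space path_space) (\<lambda>w. restrict w {0..T}) (PiM {0..T} (\<lambda>_. borel))"

text \<open>Degenerate normal laws (\<open>\<sigma> = 0\<close>) count as Gaussian.\<close>

definition gaussian_rv :: "'a measure \<Rightarrow> ('a \<Rightarrow> real) \<Rightarrow> bool" where
  "gaussian_rv M X \<longleftrightarrow> X \<in> borel_measurable M \<and>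
     (\<exists>\<mu> \<sigma>. \<sigma> \<ge> 0 \<and> distr M borel X =
        (if \<sigma> = 0 then return borel \<mu> else density lborel (\<lambda>x. ennreal (normal_density \<mu> \<sigma> x))))"

definition gaussian_family :: "'a measure \<Rightarrow> 'i set \<Rightarrow> ('i \<Rightarrow> 'a \<Rightarrow> real) \<Rightarrow> bool" where
  "gaussian_family M I X \<longleftrightarrow>
     (\<forall>F c. finite F \<and> F \<subseteq> I \<longrightarrow> gaussian_rv M (\<lambda>w. \<Sum>i\<in>F. c i * X i w))"

definition centred_gaussian_process :: "(real \<Rightarrow> real) measure \<Rightarrow> bool" where
  "centred_gaussian_process Q \<longleftrightarrow> path_law Q \<and>
     gaussian_family Q {0..} (\<lambda>t w. w t) \<and> (\<forall>t\<ge>0. (\<integral>w. w t \<partial>Q) = 0)"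

definition wiener_law :: "(real \<Rightarrow> real) measure \<Rightarrow> bool" where
  "wiener_law Q \<longleftrightarrow> path_law Q \<and> (AE w in Q. w 0 = 0) \<and>
     (\<forall>s t. 0 \<le> s \<and> s < t \<longrightarrow>
        distributed Q lborel (\<lambda>w. w t - w s) (normal_density 0 (sqrt (t - s)))) \<and>
     (\<forall>k t. 0 \<le> t 0 \<and> mono_on {..k} t \<longrightarrow>
        prob_space.indep_vars Q (\<lambda>_. borel) (\<lambda>i w. w (t (Suc i)) - w (t i)) {..<k::nat})"

text \<open>Step functions take the value \<open>c i\<close> on \<open>(t i, t (i + 1)]\<close> for \<open>i < k\<close>.\<close>

definition partition_of :: "real \<Rightarrow> nat \<Rightarrow> (nat \<Rightarrow> real) \<Rightarrow> bool" where
  "partition_of T k t \<longleftrightarrow> 0 \<le> t 0 \<and> t k \<le> T \<and> mono_on {..k} t"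

definition step_fun :: "nat \<Rightarrow> (nat \<Rightarrow> real) \<Rightarrow> (nat \<Rightarrow> real) \<Rightarrow> real \<Rightarrow> real" where
  "step_fun k t c x = (\<Sum>i<k. c i * indicator {t i<..t (Suc i)} x)"

definition step_integral :: "nat \<Rightarrow> (nat \<Rightarrow> real) \<Rightarrow> (nat \<Rightarrow> real) \<Rightarrow> (real \<Rightarrow> real) \<Rightarrow> real" where
  "step_integral k t c w = (\<Sum>i<k. c i * (w (t (Suc i)) - w (t i)))"

text \<open>\<open>J\<close> is a version of \<open>\<integral>\<^sub>0\<^sup>T f dw\<close> under the law \<open>M\<close>: it depends on the path up to time \<open>T\<close>
  only, and is the limit in probability of the integrals of step functions that converge to \<open>f\<close>
  in \<open>L\<^sub>2[0,T]\<close>. Since step functions are dense, such \<open>J\<close> is almost surely unique, and the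
  integral is almost surely linear in \<open>f\<close>.\<close>

definition has_stoch_integral ::
    "(real \<Rightarrow> real) measure \<Rightarrow> real \<Rightarrow> (real \<Rightarrow> real) \<Rightarrow> ((real \<Rightarrow> real) \<Rightarrow> real) \<Rightarrow> bool" where
  "has_stoch_integral M T f J \<longleftrightarrow> J \<in> borel_measurable (history T) \<and>
     (\<forall>\<epsilon>>0. \<exists>\<delta>>0. \<forall>k t c.
        partition_of T k t \<and> norm_L2 T (\<lambda>x. step_fun k t c x - f x) < \<delta> \<longrightarrow>
        measure M {w \<in> space M. \<bar>step_integral k t c w - J w\<bar> > \<epsilon>} < \<epsilon>)"

definition stoch_integral ::
    "(real \<Rightarrow> real) measure \<Rightarrow> real \<Rightarrow> (real \<Rightarrow> real) \<Rightarrow> (real \<Rightarrow> real) \<Rightarrow> real" where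
  "stoch_integral M T f = (SOME J. has_stoch_integral M T f J)"

definition noise_coeff ::
    "(nat \<Rightarrow> real \<Rightarrow> real) \<Rightarrow> (real \<Rightarrow> real) measure \<Rightarrow> nat \<Rightarrow> nat \<Rightarrow> (real \<Rightarrow> real) \<Rightarrow> real" where
  "noise_coeff \<phi> Q n j w = stoch_integral Q (real n) (\<phi> j) w / sqrt (real n)"

definition cov :: "'a measure \<Rightarrow> ('a \<Rightarrow> real) \<Rightarrow> ('a \<Rightarrow> real) \<Rightarrow> real" where
  "cov M X Y = (\<integral>w. (X w - (\<integral>v. X v \<partial>M)) * (Y w - (\<integral>v. Y v \<partial>M)) \<partial>M)"

text \<open>Matrix indices start at 0, basis functions at 1.\<close>

definition noise_cov ::
    "(nat \<Rightarrow> real \<Rightarrow> real) \<Rightarrow> (real \<Rightarrow> real) measure \<Rightarrow> nat \<Rightarrow> nat \<Rightarrow> real Matrix.mat" where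
  "noise_cov \<phi> Q k n = Matrix.mat k k
     (\<lambda>(i, j). cov Q (noise_coeff \<phi> Q n (Suc i)) (noise_coeff \<phi> Q n (Suc j)))"

text \<open>Only used for symmetric matrices, whose eigenvalues are all real.\<close>

definition lambda_max :: "real Matrix.mat \<Rightarrow> real" where
  "lambda_max A = Max (spectrum A)"

definition admissible_noise ::
    "(nat \<Rightarrow> real \<Rightarrow> real) \<Rightarrow> real \<Rightarrow> (real \<Rightarrow> real) measure \<Rightarrow> bool" where
  "admissible_noise \<phi> \<kappa> Q \<longleftrightarrow> centred_gaussian_process Q \<and>
     (\<forall>n\<ge>1. \<forall>f\<in>L2_on (real n). \<exists>J. has_stoch_integral Q (real n) f J) \<and>
     (\<forall>n\<ge>1. \<forall>k\<ge>1. gaussian_family Q {1..k} (noise_coeff \<phi> Q n) \<and>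
                    Determinant.det (noise_cov \<phi> Q k n) \<noteq> 0) \<and>
     (\<exists>l. (\<forall>k\<ge>1. \<forall>n\<ge>1. lambda_max (noise_cov \<phi> Q k n) \<le> l) \<and> l \<le> \<kappa>)"

definition noise_class ::
    "(nat \<Rightarrow> real \<Rightarrow> real) \<Rightarrow> real \<Rightarrow> (real \<Rightarrow> real) measure set \<Rightarrow> bool" where
  "noise_class \<phi> \<kappa> P \<longleftrightarrow> (\<exists>Q0\<in>P. wiener_law Q0) \<and> (\<forall>Q\<in>P. admissible_noise \<phi> \<kappa> Q)"

text \<open>The equation determines \<open>y\<close> up to its initial value; we take \<open>y 0 = \<xi> 0\<close>. Everything below
  depends on increments of \<open>y\<close> only.\<close>

definition observe :: "(real \<Rightarrow> real) \<Rightarrow> (real \<Rightarrow> real) \<Rightarrow> real \<Rightarrow> real" where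
  "observe S w = (\<lambda>t\<in>{0..}. (LINT s:{0..t}|lebesgue. S s) + w t)"

definition obs_law :: "(real \<Rightarrow> real) \<Rightarrow> (real \<Rightarrow> real) measure \<Rightarrow> (real \<Rightarrow> real) measure" where
  "obs_law S Q = distr Q path_space (observe S)"

text \<open>An estimator maps the observed path to a function. It also takes the law of the observations
  as an argument, because integrals \<open>\<integral> f dy\<close> are only defined almost surely with respect to that
  law; the estimators below use the law only to choose versions of such integrals.\<close>

type_synonym estimator = "(real \<Rightarrow> real) measure \<Rightarrow> (real \<Rightarrow> real) \<Rightarrow> real \<Rightarrow> real"

definition rate :: "nat \<Rightarrow> real \<Rightarrow> real" where
  "rate n \<beta> = real n powr (\<beta> / (2 * \<beta> + 1))"

definition risk ::
    "(nat \<Rightarrow> real \<Rightarrow> real) \<Rightarrow> real \<Rightarrow> (real \<Rightarrow> real) measure set \<Rightarrow> nat \<Rightarrow> estimator \<Rightarrow> real \<Rightarrow> ennreal" where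
  "risk \<phi> r P n E \<beta> = (SUP S\<in>Theta \<phi> \<beta> r. SUP Q\<in>P.
     \<integral>\<^sup>+ y. ennreal ((norm_L2 1 (\<lambda>t. rate n \<beta> * (E (obs_law S Q) y t - S t)))\<^sup>2) \<partial>obs_law S Q)"

definition models :: "nat \<Rightarrow> nat set set" where
  "models n = (\<lambda>i. {1..i}) ` {1..n}"

definition coeff_est ::
    "(nat \<Rightarrow> real \<Rightarrow> real) \<Rightarrow> nat \<Rightarrow> (real \<Rightarrow> real) measure \<Rightarrow> (real \<Rightarrow> real) \<Rightarrow> nat \<Rightarrow> real" where
  "coeff_est \<phi> n M y j = stoch_integral M (real n) (\<phi> j) y / real n"

definition lse :: "(nat \<Rightarrow> real \<Rightarrow> real) \<Rightarrow> nat \<Rightarrow> nat set \<Rightarrow> estimator" where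
  "lse \<phi> n m M y = (\<lambda>t. \<Sum>j\<in>m. coeff_est \<phi> n M y j * \<phi> j t)"

text \<open>The empirical contrast \<open>\<gamma>\<^sub>n\<close> at the combination of \<open>\<phi> j\<close>, \<open>j \<in> m\<close>, with possibly random
  coefficients \<open>a j\<close>.\<close>

definition contrast :: "(nat \<Rightarrow> real \<Rightarrow> real) \<Rightarrow> nat \<Rightarrow> (real \<Rightarrow> real) measure \<Rightarrow> (real \<Rightarrow> real) \<Rightarrow>
    nat set \<Rightarrow> (nat \<Rightarrow> real) \<Rightarrow> real" where
  "contrast \<phi> n M y m a = (norm_L2 1 (\<lambda>t. \<Sum>j\<in>m. a j * \<phi> j t))\<^sup>2
     - 2 / real n * (\<Sum>j\<in>m. a j * stoch_integral M (real n) (\<phi> j) y)"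

definition z_star :: real where
  "z_star = (GREATEST z. z > 0 \<and> ln z = z - 2)"

definition penalty :: "real \<Rightarrow> nat \<Rightarrow> nat set \<Rightarrow> real" where
  "penalty \<kappa> n m = 4 * \<kappa> * (z_star\<^sup>2 / (z_star - 1)) * (real (card m) / real n)"

definition selected_model :: "(nat \<Rightarrow> real \<Rightarrow> real) \<Rightarrow> real \<Rightarrow> nat \<Rightarrow> (real \<Rightarrow> real) measure \<Rightarrow>
    (real \<Rightarrow> real) \<Rightarrow> nat set" where
  "selected_model \<phi> \<kappa> n M y =
     arg_min_on (\<lambda>m. contrast \<phi> n M y m (coeff_est \<phi> n M y) + penalty \<kappa> n m) (models n)"

definition model_selection_est :: "(nat \<Rightarrow> real \<Rightarrow> real) \<Rightarrow> real \<Rightarrow> nat \<Rightarrow> estimator" where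
  "model_selection_est \<phi> \<kappa> n M y = lse \<phi> n (selected_model \<phi> \<kappa> n M y) M y"

end

theory Submission
  imports Defs
begin

text \<open>
  With \<open>\<zeta> j\<close> the noise coefficients and \<open>s j\<close> the coefficients of \<open>S\<close>, the estimated coefficients are
  \<open>s j + \<zeta> j / sqrt n\<close>, and the criterion at the model \<open>{1..i}\<close> is minus the sum of their squares up to
  \<open>i\<close> plus \<open>K i / n\<close>, where \<open>K = 4 \<kappa> z\<^sub>*\<^sup>2 / (z\<^sub>* - 1) \<ge> 16 \<kappa>\<close>. Comparing the selected model with an
  arbitrary \<open>i\<close> bounds the loss by a multiple of the tail energy beyond \<open>i\<close>, the noise energy of
  \<open>{1..i}\<close>, \<open>i / n\<close>, and the excess of the noise energies of all models over \<open>4 \<kappa> d / n\<close>.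
  This excess has expectation \<open>O(1 / n)\<close>, since \<open>E exp (\<Sum>j\<le>a. \<zeta> j\<^sup>2 / (4 \<kappa>)) \<le> sqrt 2 ^ a\<close> and
  \<open>sqrt 2 < exp 1\<close>. The choice \<open>i = \<lfloor>n powr (1 / (2 \<beta> + 1))\<rfloor>\<close> gives a bound uniform in \<open>\<beta>\<close>.
\<close>

section \<open>Square integrable functions\<close>

lemma abs_mult_le_sum_squares: "\<bar>a * b\<bar> \<le> a\<^sup>2 + (b :: real)\<^sup>2"
  using sum_squares_bound[of "\<bar>a\<bar>" "\<bar>b\<bar>"] mult_nonneg_nonneg[of "\<bar>a\<bar>" "\<bar>b\<bar>"]
  unfolding abs_mult power2_abs by linarith

lemma L2_on_iff:
  "f \<in> L2_on T \<longleftrightarrow> f \<in> borel_measurable (lebesgue_on {0..T}) \<and>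
     integrable (lebesgue_on {0..T}) (\<lambda>t. (f t)\<^sup>2)"
  by (simp add: L2_on_def set_borel_measurable_def set_integrable_def
      borel_measurable_restrict_space_iff integrable_restrict_space)

lemma inner_L2_eq: "inner_L2 T f g = (LINT t|lebesgue_on {0..T}. f t * g t)"
  by (simp add: inner_L2_def set_lebesgue_integral_def integral_restrict_space)

lemma L2_on_integrable_mult:
  assumes "f \<in> L2_on T" "g \<in> L2_on T"
  shows "integrable (lebesgue_on {0..T}) (\<lambda>t. f t * g t)"
proof (rule Bochner_Integration.integrable_bound)
  show "integrable (lebesgue_on {0..T}) (\<lambda>t. (f t)\<^sup>2 + (g t)\<^sup>2)"
    using assms by (auto simp: L2_on_iff)
  show "(\<lambda>t. f t * g t) \<in> borel_measurable (lebesgue_on {0..T})"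
    using assms by (auto simp: L2_on_iff)
  show "AE t in lebesgue_on {0..T}. norm (f t * g t) \<le> norm ((f t)\<^sup>2 + (g t)\<^sup>2)"
    using abs_mult_le_sum_squares by auto
qed

lemma L2_on_add:
  assumes "f \<in> L2_on T" "g \<in> L2_on T"
  shows "(\<lambda>t. f t + g t) \<in> L2_on T"
  using assms L2_on_integrable_mult[OF assms]
  by (auto simp: L2_on_iff power2_sum mult.assoc)

lemma L2_on_scale: "f \<in> L2_on T \<Longrightarrow> (\<lambda>t. c * f t) \<in> L2_on T"
  by (auto simp: L2_on_iff power_mult_distrib)

lemma L2_on_zero: "(\<lambda>t. 0) \<in> L2_on T"
  by (simp add: L2_on_iff)

lemma L2_on_diff:
  assumes "f \<in> L2_on T" "g \<in> L2_on T"
  shows "(\<lambda>t. f t - g t) \<in> L2_on T"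
  using L2_on_add[OF assms(1) L2_on_scale[OF assms(2), of "-1"]] by simp

lemma L2_on_sum: "(\<And>i. i \<in> A \<Longrightarrow> f i \<in> L2_on T) \<Longrightarrow> (\<lambda>t. \<Sum>i\<in>A. f i t) \<in> L2_on T"
  by (induction A rule: infinite_finite_induct) (auto intro: L2_on_zero L2_on_add)

lemma inner_L2_commute: "inner_L2 T f g = inner_L2 T g f"
  by (simp add: inner_L2_def mult.commute)

lemma inner_L2_diff_left:
  "f \<in> L2_on T \<Longrightarrow> g \<in> L2_on T \<Longrightarrow> h \<in> L2_on T \<Longrightarrow>
   inner_L2 T (\<lambda>t. f t - g t) h = inner_L2 T f h - inner_L2 T g h"
  by (simp add: inner_L2_eq left_diff_distrib L2_on_integrable_mult)

lemma inner_L2_scale_left: "inner_L2 T (\<lambda>t. c * f t) g = c * inner_L2 T f g"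
  by (simp add: inner_L2_eq mult.assoc)

lemma inner_L2_sum_left:
  assumes "\<And>i. i \<in> A \<Longrightarrow> f i \<in> L2_on T" "g \<in> L2_on T"
  shows "inner_L2 T (\<lambda>t. \<Sum>i\<in>A. f i t) g = (\<Sum>i\<in>A. inner_L2 T (f i) g)"
  using assms by (simp add: inner_L2_eq sum_distrib_right L2_on_integrable_mult)

lemma inner_L2_self_nonneg: "0 \<le> inner_L2 T f f"
  by (simp add: inner_L2_eq)

lemma norm_L2_square: "(norm_L2 T f)\<^sup>2 = inner_L2 T f f"
  by (simp add: norm_L2_def inner_L2_self_nonneg)

lemma norm_L2_nonneg: "0 \<le> norm_L2 T f"
  by (simp add: norm_L2_def inner_L2_self_nonneg)

lemma norm_L2_scale: "(norm_L2 T (\<lambda>t. c * f t))\<^sup>2 = c\<^sup>2 * (norm_L2 T f)\<^sup>2"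
  unfolding norm_L2_square inner_L2_scale_left
  by (subst inner_L2_commute) (simp add: inner_L2_scale_left power2_eq_square)

lemma norm_L2_diff_square:
  assumes "f \<in> L2_on T" "g \<in> L2_on T"
  shows "(norm_L2 T (\<lambda>t. f t - g t))\<^sup>2 = (norm_L2 T f)\<^sup>2 - 2 * inner_L2 T f g + (norm_L2 T g)\<^sup>2"
proof -
  note fg = L2_on_diff[OF assms]
  have "(norm_L2 T (\<lambda>t. f t - g t))\<^sup>2
      = inner_L2 T f (\<lambda>t. f t - g t) - inner_L2 T g (\<lambda>t. f t - g t)"
    unfolding norm_L2_square by (rule inner_L2_diff_left[OF assms fg])
  also have "inner_L2 T f (\<lambda>t. f t - g t) = inner_L2 T f f - inner_L2 T g f"
    by (subst inner_L2_commute) (rule inner_L2_diff_left[OF assms assms(1)])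
  also have "inner_L2 T g (\<lambda>t. f t - g t) = inner_L2 T f g - inner_L2 T g g"
    by (subst inner_L2_commute) (rule inner_L2_diff_left[OF assms assms(2)])
  finally show ?thesis
    by (simp add: norm_L2_square inner_L2_commute[of T g f])
qed

lemma quadratic_nonneg_discriminant:
  fixes a b c :: real
  assumes *: "\<And>x. 0 \<le> a - 2 * (x * b) + x\<^sup>2 * c" and "0 \<le> c"
  shows "b\<^sup>2 \<le> a * c"
proof (cases "c = 0")
  case True
  have "b = 0"
  proof (rule ccontr)
    assume "b \<noteq> 0"
    then show False
      using *[of "(a + 1) / (2 * b)"] True by simp
  qed
  then show ?thesis using True by simp
next
  case False
  with assms(2) have "c > 0" by simp
  from False have "a - 2 * (b / c * b) + (b / c)\<^sup>2 * c = a - b\<^sup>2 / c"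
    by (simp add: field_simps power2_eq_square)
  then have "0 \<le> a - b\<^sup>2 / c"
    using *[of "b / c"] by linarith
  with \<open>c > 0\<close> show ?thesis
    by (simp add: field_simps)
qed

lemma inner_L2_Cauchy_Schwarz:
  assumes "f \<in> L2_on T" "g \<in> L2_on T"
  shows "\<bar>inner_L2 T f g\<bar> \<le> norm_L2 T f * norm_L2 T g"
proof -
  let ?A = "(norm_L2 T f)\<^sup>2" and ?B = "inner_L2 T f g" and ?C = "(norm_L2 T g)\<^sup>2"
  have *: "0 \<le> ?A - 2 * (x * ?B) + x\<^sup>2 * ?C" for x
  proof -
    have "inner_L2 T f (\<lambda>t. x * g t) = x * ?B"
      by (subst inner_L2_commute) (simp add: inner_L2_scale_left inner_L2_commute)
    then show ?thesis
      using norm_L2_diff_square[OF assms(1) L2_on_scale[OF assms(2), of x]] zero_le_power2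
      by (metis norm_L2_scale)
  qed
  have "?B\<^sup>2 \<le> ?A * ?C"
    by (rule quadratic_nonneg_discriminant) (use * in auto)
  then have "\<bar>?B\<bar>\<^sup>2 \<le> (norm_L2 T f * norm_L2 T g)\<^sup>2"
    by (simp add: power_mult_distrib)
  then show ?thesis
    by (rule power2_le_imp_le) (simp add: norm_L2_nonneg)
qed

lemma norm_L2_triangle:
  assumes "f \<in> L2_on T" "g \<in> L2_on T" "h \<in> L2_on T"
  shows "norm_L2 T (\<lambda>t. f t - h t) \<le> norm_L2 T (\<lambda>t. f t - g t) + norm_L2 T (\<lambda>t. h t - g t)"
proof (rule power2_le_imp_le)
  let ?a = "\<lambda>t. f t - g t" and ?b = "\<lambda>t. h t - g t"
  have ab: "?a \<in> L2_on T" "?b \<in> L2_on T"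
    using assms by (auto intro: L2_on_diff)
  have "(norm_L2 T (\<lambda>t. f t - h t))\<^sup>2 = (norm_L2 T (\<lambda>t. ?a t - ?b t))\<^sup>2"
    by simp
  also have "\<dots> = (norm_L2 T ?a)\<^sup>2 - 2 * inner_L2 T ?a ?b + (norm_L2 T ?b)\<^sup>2"
    by (rule norm_L2_diff_square[OF ab])
  also have "\<dots> \<le> (norm_L2 T ?a + norm_L2 T ?b)\<^sup>2"
    using inner_L2_Cauchy_Schwarz[OF ab] by (simp add: power2_sum)
  finally show "(norm_L2 T (\<lambda>t. f t - h t))\<^sup>2 \<le> (norm_L2 T ?a + norm_L2 T ?b)\<^sup>2" .
  show "0 \<le> norm_L2 T ?a + norm_L2 T ?b"
    by (simp add: norm_L2_nonneg)
qed

lemma bounded_measurable_L2_on: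
  assumes "f \<in> borel_measurable (lebesgue_on {0..T})" "\<And>t. t \<in> {0..T} \<Longrightarrow> \<bar>f t\<bar> \<le> B"
  shows "f \<in> L2_on T"
proof -
  have "integrable (lebesgue_on {0..T}) (\<lambda>t. (f t)\<^sup>2)"
  proof (rule Bochner_Integration.integrable_bound)
    show "integrable (lebesgue_on {0..T}) (\<lambda>_. B\<^sup>2)"
      by (rule finite_measure.integrable_const, rule finite_measure_lebesgue_on) auto
    have "\<bar>f t\<bar>\<^sup>2 \<le> B\<^sup>2" if "t \<in> {0..T}" for t
      using assms(2)[OF that] by (intro power_mono) auto
    then show "AE t in lebesgue_on {0..T}. norm ((f t)\<^sup>2) \<le> norm (B\<^sup>2)"
      by (auto simp: space_restrict_space)
  qed (use assms(1) in auto)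
  then show ?thesis
    using assms(1) by (simp add: L2_on_iff)
qed

lemma continuous_L2_on:
  assumes "continuous_on {0..T} f"
  shows "f \<in> L2_on T"
proof -
  obtain B where "\<And>t. t \<in> {0..T} \<Longrightarrow> \<bar>f t\<bar> \<le> B"
    using compact_imp_bounded[OF compact_continuous_image[OF assms compact_Icc]]
    by (fastforce simp: bounded_iff)
  then show ?thesis
    by (intro bounded_measurable_L2_on continuous_imp_measurable_on_sets_lebesgue assms) auto
qed

lemma norm_L2_tendsto_zero:
  assumes "\<And>k. f k \<in> borel_measurable (lebesgue_on {0..T})" "w \<in> L2_on T"
    and "\<And>k t. t \<in> {0..T} \<Longrightarrow> \<bar>f k t\<bar> \<le> \<bar>w t\<bar>"
    and "AE t in lebesgue_on {0..T}. (\<lambda>k. f k t) \<longlonglongrightarrow> 0"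
  shows "(\<lambda>k. norm_L2 T (f k)) \<longlonglongrightarrow> 0"
proof -
  have "(\<lambda>k. LINT t|lebesgue_on {0..T}. f k t * f k t) \<longlonglongrightarrow> (LINT t|lebesgue_on {0..T}. 0)"
  proof (rule integral_dominated_convergence)
    show "integrable (lebesgue_on {0..T}) (\<lambda>t. (w t)\<^sup>2)"
      using assms(2) by (simp add: L2_on_iff)
    show "AE t in lebesgue_on {0..T}. (\<lambda>k. f k t * f k t) \<longlonglongrightarrow> 0"
      using assms(4) by eventually_elim (auto intro: tendsto_mult_zero)
    have "\<bar>f k t\<bar> * \<bar>f k t\<bar> \<le> (w t)\<^sup>2" if "t \<in> {0..T}" for k t
      using mult_mono[OF assms(3)[OF that] assms(3)[OF that], of k k]
      by (simp add: power2_eq_square)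
    then show "AE t in lebesgue_on {0..T}. norm (f k t * f k t) \<le> (w t)\<^sup>2" for k
      by (auto simp: space_restrict_space abs_mult)
  qed (use assms(1) in auto)
  then have "(\<lambda>k. sqrt (inner_L2 T (f k) (f k))) \<longlonglongrightarrow> sqrt 0"
    by (intro tendsto_intros) (simp add: inner_L2_eq)
  then show ?thesis
    by (simp add: norm_L2_def)
qed

section \<open>Density of step functions\<close>

lemma step_fun_uniform_mesh:
  fixes k :: nat
  assumes "0 < x" "x \<le> T"
  defines "t \<equiv> \<lambda>i. T * real i / real (Suc k)"
  obtains u where "u \<in> {0..T}" "\<bar>u - x\<bar> \<le> T / real (Suc k)"
    "step_fun (Suc k) t (\<lambda>i. g (t (Suc i))) x = g u"
proof -
  have T: "T > 0" using assms by simp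
  define a where "a = x * real (Suc k) / T"
  define j where "j = nat (\<lceil>a\<rceil> - 1)"
  have a: "0 < a" "a \<le> real (Suc k)"
    using assms(1,2) T
    by (auto simp: a_def pos_divide_le_eq mult.commute[of x] intro!: mult_left_mono simp del: of_nat_Suc)
  then have "1 \<le> \<lceil>a\<rceil>" by (simp add: one_le_ceiling)
  then have "real j = real_of_int \<lceil>a\<rceil> - 1"
    by (simp add: j_def)
  then have j: "real j < a" "a \<le> real (Suc j)"
    by linarith+
  have jk: "j < Suc k"
    using j a by linarith
  have tj: "t j < x" "x \<le> t (Suc j)"
    using j T by (auto simp: t_def a_def field_simps)
  have mono: "t i \<le> t i'" if "i \<le> i'" for i i'
    using that T by (simp add: t_def divide_right_mono)
  have ind: "indicator {t i<..t (Suc i)} x = (if i = j then 1 else 0 :: real)" for i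
    using tj mono[of "Suc i" j] mono[of "Suc j" i]
    by (cases i j rule: linorder_cases) (auto simp: indicator_def)
  show ?thesis
  proof
    show "t (Suc j) \<in> {0..T}"
      using T jk by (auto simp: t_def field_simps)
    have "t (Suc j) - t j = T / real (Suc k)"
      by (simp add: t_def diff_divide_distrib[symmetric] algebra_simps)
    then show "\<bar>t (Suc j) - x\<bar> \<le> T / real (Suc k)"
      using tj by simp
    show "step_fun (Suc k) t (\<lambda>i. g (t (Suc i))) x = g (t (Suc j))"
      unfolding step_fun_def ind using jk
      by (simp add: if_distrib[of "(*) _"] del: sum.lessThan_Suc cong: if_cong)
  qed
qed

lemma step_fun_measurable [measurable]: "step_fun k t c \<in> borel_measurable borel"
  unfolding step_fun_def[abs_def] by measurable

lemma borel_measurable_lebesgue_on [intro]: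
  "f \<in> borel_measurable borel \<Longrightarrow> f \<in> borel_measurable (lebesgue_on S)"
  by (simp add: borel_measurable_if_I measurable_completion measurable_restrict_space1)

lemma step_fun_L2_on: "step_fun k t c \<in> L2_on T"
proof (rule bounded_measurable_L2_on)
  have "\<bar>c i * indicator {t i<..t (Suc i)} x\<bar> \<le> \<bar>c i\<bar>" for i x
    by (auto simp: indicator_def)
  then show "\<bar>step_fun k t c x\<bar> \<le> (\<Sum>i<k. \<bar>c i\<bar>)" for x
    unfolding step_fun_def by (intro order_trans[OF sum_abs] sum_mono)
qed (auto intro: step_fun_measurable)

lemma continuous_approx_step_fun:
  assumes "0 < T" "continuous_on {0..T} g" "0 < \<delta>"
  shows "\<exists>k t c. partition_of T k t \<and> norm_L2 T (\<lambda>x. step_fun k t c x - g x) < \<delta>"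
proof -
  define t where "t k i = T * real i / real (Suc k)" for k i
  define s where "s k = step_fun (Suc k) (t k) (\<lambda>i. g (t k (Suc i)))" for k
  have approx: "\<exists>u\<in>{0..T}. \<bar>u - x\<bar> \<le> T / real (Suc k) \<and> s k x = g u" if "0 < x" "x \<le> T" for k x
    unfolding s_def t_def by (rule step_fun_uniform_mesh[OF that, where k=k and g=g]) auto
  obtain B where B: "\<And>t. t \<in> {0..T} \<Longrightarrow> \<bar>g t\<bar> \<le> B"
    using compact_imp_bounded[OF compact_continuous_image[OF assms(2) compact_Icc]]
    by (fastforce simp: bounded_iff)
  have B0: "0 \<le> B" using B[of 0] assms(1) by auto
  have "0 \<le> t k i" for k i
    using assms(1) by (simp add: t_def)
  then have s0: "s k 0 = 0" for k
    unfolding s_def step_fun_def by (intro sum.neutral) (auto simp: indicator_def not_less)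
  have "(\<lambda>k. norm_L2 T (\<lambda>x. s k x - g x)) \<longlonglongrightarrow> 0"
  proof (rule norm_L2_tendsto_zero)
    show "(\<lambda>x. s k x - g x) \<in> borel_measurable (lebesgue_on {0..T})" for k
      using L2_on_diff[OF step_fun_L2_on continuous_L2_on[OF assms(2)]]
      unfolding s_def L2_on_iff by blast
    show "(\<lambda>_. 2 * B) \<in> L2_on T"
      by (rule continuous_L2_on) auto
    show "\<bar>s k x - g x\<bar> \<le> \<bar>2 * B\<bar>" if x: "x \<in> {0..T}" for k x
    proof (cases "x = 0")
      case True
      then show ?thesis using s0 B[OF x] B0 by simp
    next
      case False
      with x approx[of x k] obtain u where "u \<in> {0..T}" "s k x = g u" by auto
      then show ?thesis using B[of u] B[OF x] by simp
    qed
    have lim: "(\<lambda>k. s k x - g x) \<longlonglongrightarrow> 0" if x: "x \<in> {0..T}" "x \<noteq> 0" for x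
    proof -
      have "\<forall>k. \<exists>u\<in>{0..T}. \<bar>u - x\<bar> \<le> T / real (Suc k) \<and> s k x = g u"
        using approx x by auto
      then obtain u where u: "\<And>k. u k \<in> {0..T}" "\<And>k. \<bar>u k - x\<bar> \<le> T / real (Suc k)"
        "\<And>k. s k x = g (u k)" by metis
      have "(\<lambda>k. u k - x) \<longlonglongrightarrow> 0"
      proof (rule Lim_null_comparison)
        show "\<forall>\<^sub>F k in sequentially. norm (u k - x) \<le> T / real (Suc k)"
          using u(2) by simp
        show "(\<lambda>k. T / real (Suc k)) \<longlonglongrightarrow> 0"
          by real_asymp
      qed
      then have "u \<longlonglongrightarrow> x" by (simp add: LIM_zero_iff)
      then have "(\<lambda>k. g (u k)) \<longlonglongrightarrow> g x"
        using assms(2) x(1) u(1) by (auto intro: continuous_on_tendsto_compose)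
      then show ?thesis by (simp add: u(3) LIM_zero)
    qed
    have "AE x in lebesgue_on {0..T}. x \<noteq> 0"
      by (rule AE_I[of _ _ "{0}"]) (auto simp: emeasure_restrict_space sets_restrict_space_iff assms(1) less_imp_le)
    then show "AE x in lebesgue_on {0..T}. (\<lambda>k. s k x - g x) \<longlonglongrightarrow> 0"
      by (rule AE_mp) (auto intro!: AE_I2 lim)
  qed
  from LIMSEQ_D[OF this assms(3)] obtain k where "norm_L2 T (\<lambda>x. s k x - g x) < \<delta>"
    using norm_L2_nonneg by auto
  moreover have "partition_of T (Suc k) (t k)"
    using assms(1) by (auto simp: partition_of_def t_def mono_on_def intro!: divide_right_mono mult_left_mono)
  ultimately show ?thesis
    unfolding s_def by blast
qed

definition clip :: "real \<Rightarrow> real \<Rightarrow> real" where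
  "clip B x = max (- B) (min B x)"

lemma step_fun_dense:
  assumes "0 < T" "f \<in> L2_on T" "0 < \<delta>"
  shows "\<exists>k t c. partition_of T k t \<and> norm_L2 T (\<lambda>x. step_fun k t c x - f x) < \<delta>"
proof -
  have fm: "f \<in> borel_measurable (lebesgue_on {0..T})"
    using assms(2) by (simp add: L2_on_iff)
  have clip_m: "(\<lambda>x. clip (real B) (f x)) \<in> borel_measurable (lebesgue_on {0..T})" for B
    using fm unfolding clip_def by measurable
  have clip_L2: "(\<lambda>x. clip (real B) (f x)) \<in> L2_on T" for B
    by (rule bounded_measurable_L2_on[OF clip_m, of _ "real B"]) (auto simp: clip_def)
  have "(\<lambda>B. norm_L2 T (\<lambda>x. clip (real B) (f x) - f x)) \<longlonglongrightarrow> 0"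
  proof (rule norm_L2_tendsto_zero)
    show "(\<lambda>x. clip (real B) (f x) - f x) \<in> borel_measurable (lebesgue_on {0..T})" for B
      using fm clip_m by auto
    have "(\<lambda>B. clip (real B) (f x) - f x) \<longlonglongrightarrow> 0" for x
    proof (rule tendsto_eventually)
      obtain N :: nat where "\<bar>f x\<bar> \<le> real N" using real_arch_simple by blast
      then have "clip (real B) (f x) - f x = 0" if "B \<ge> N" for B
        using that by (auto simp: clip_def)
      then show "\<forall>\<^sub>F B in sequentially. clip (real B) (f x) - f x = 0"
        by (auto simp: eventually_sequentially)
    qed
    then show "AE x in lebesgue_on {0..T}. (\<lambda>B. clip (real B) (f x) - f x) \<longlonglongrightarrow> 0"
      by simp
  qed (use assms(2) in \<open>auto simp: clip_def\<close>)
  from LIMSEQ_D[OF this, of "\<delta>/3"] assms(3)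
  obtain B where B: "norm_L2 T (\<lambda>x. clip (real B) (f x) - f x) < \<delta> / 3"
    using norm_L2_nonneg by auto
  from fm have "f measurable_on {0..T}"
    by (simp add: measurable_on_iff_borel_measurable)
  then obtain N g where N: "negligible N" and g: "\<And>n. continuous_on UNIV (g n :: real \<Rightarrow> real)"
    and gf: "\<And>x. x \<notin> N \<Longrightarrow> (\<lambda>n. g n x) \<longlonglongrightarrow> (if x \<in> {0..T} then f x else 0)"
    unfolding measurable_on_def by blast
  have clip_cont: "continuous_on {0..T} (\<lambda>x. clip (real B) (g n x))" for n
    unfolding clip_def by (intro continuous_intros continuous_on_subset[OF g]) auto
  have "(\<lambda>n. norm_L2 T (\<lambda>x. clip (real B) (g n x) - clip (real B) (f x))) \<longlonglongrightarrow> 0"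
  proof (rule norm_L2_tendsto_zero)
    show "(\<lambda>x. clip (real B) (g n x) - clip (real B) (f x)) \<in> borel_measurable (lebesgue_on {0..T})" for n
      using L2_on_diff[OF continuous_L2_on[OF clip_cont] clip_L2]
      unfolding L2_on_iff by blast
    show "(\<lambda>_. 2 * real B) \<in> L2_on T"
      by (rule continuous_L2_on) auto
    have "AE x in lebesgue_on {0..T}. x \<notin> N"
      using N by (auto simp: negligible_iff_null_sets AE_restrict_space_iff intro: AE_mp[OF AE_not_in])
    then show "AE x in lebesgue_on {0..T}. (\<lambda>n. clip (real B) (g n x) - clip (real B) (f x)) \<longlonglongrightarrow> 0"
    proof (rule AE_mp, intro AE_I2 impI)
      fix x assume x: "x \<in> space (lebesgue_on {0..T})" "x \<notin> N"
      then have "(\<lambda>n. g n x) \<longlonglongrightarrow> f x"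
        using gf[of x] by (simp add: space_restrict_space)
      then have "(\<lambda>n. clip (real B) (g n x)) \<longlonglongrightarrow> clip (real B) (f x)"
        unfolding clip_def by (intro tendsto_intros)
      then show "(\<lambda>n. clip (real B) (g n x) - clip (real B) (f x)) \<longlonglongrightarrow> 0"
        by (rule LIM_zero)
    qed
  qed (auto simp: clip_def)
  from LIMSEQ_D[OF this, of "\<delta>/3"] assms(3)
  obtain n where n: "norm_L2 T (\<lambda>x. clip (real B) (g n x) - clip (real B) (f x)) < \<delta> / 3"
    using norm_L2_nonneg by auto
  obtain k t c where part: "partition_of T k t"
    and s: "norm_L2 T (\<lambda>x. step_fun k t c x - clip (real B) (g n x)) < \<delta> / 3"
    using continuous_approx_step_fun[OF assms(1) clip_cont[of n], of "\<delta> / 3"] assms(3) by auto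
  have sym: "norm_L2 T (\<lambda>x. a x - b x) = norm_L2 T (\<lambda>x. b x - a x)" for a b
    unfolding norm_L2_def inner_L2_def by (simp add: algebra_simps)
  have "norm_L2 T (\<lambda>x. step_fun k t c x - clip (real B) (f x))
      \<le> norm_L2 T (\<lambda>x. step_fun k t c x - clip (real B) (g n x))
        + norm_L2 T (\<lambda>x. clip (real B) (f x) - clip (real B) (g n x))"
    by (rule norm_L2_triangle[OF step_fun_L2_on continuous_L2_on[OF clip_cont] clip_L2])
  moreover have "norm_L2 T (\<lambda>x. step_fun k t c x - f x)
      \<le> norm_L2 T (\<lambda>x. step_fun k t c x - clip (real B) (f x))
        + norm_L2 T (\<lambda>x. f x - clip (real B) (f x))"
    by (rule norm_L2_triangle[OF step_fun_L2_on clip_L2 assms(2)])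
  ultimately have "norm_L2 T (\<lambda>x. step_fun k t c x - f x) < \<delta>"
    using B n s sym[of "\<lambda>x. clip (real B) (f x)" f]
      sym[of "\<lambda>x. clip (real B) (f x)" "\<lambda>x. clip (real B) (g n x)"] by linarith
  with part show ?thesis by blast
qed

section \<open>Periodic functions and orthonormal expansions\<close>

lemma periodic_shift_nat:
  fixes f :: "real \<Rightarrow> 'a"
  assumes "\<And>t. f (t + 1) = f t"
  shows "f (t + real n) = f t"
proof (induction n)
  case (Suc n)
  then show ?case using assms[of "t + real n"] by (simp add: ac_simps)
qed simp

lemma periodic_borel_measurable:
  fixes f :: "real \<Rightarrow> real"
  assumes per: "\<And>t. f (t + 1) = f t" and f: "f \<in> borel_measurable (lebesgue_on {0..1})"
  shows "f \<in> borel_measurable (lebesgue_on {0..real n})"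
proof -
  have m: "(\<lambda>x. indicator {0..1} x * f x) \<in> borel_measurable lebesgue"
    using f by (simp add: borel_measurable_restrict_space_iff)
  have "(\<lambda>x. indicator {0..<1} x * (indicator {0..1} x * f x)) \<in> borel_measurable lebesgue"
    by (rule borel_measurable_times[OF borel_measurable_indicator m]) simp
  also have "(\<lambda>x. indicator {0..<1} x * (indicator {0..1} x * f x)) = (\<lambda>x. indicator {0..<1} x * f x)"
    by (intro ext) (auto simp: indicator_def)
  finally have base: "(\<lambda>x. indicator {0..<1} x * f x) \<in> borel_measurable lebesgue" .
  have half: "(\<lambda>x. indicator {0..<real n} x * f x) \<in> borel_measurable lebesgue"
  proof (induction n)
    case (Suc n)
    have "(\<lambda>x. x - real n) \<in> lebesgue \<rightarrow>\<^sub>M lebesgue"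
      using lebesgue_affine_measurable[of "\<lambda>_. 1" "- real n"] by simp
    from measurable_compose[OF this base]
    have "(\<lambda>x. indicator {0..<1} (x - real n) * f (x - real n)) \<in> borel_measurable lebesgue" .
    moreover have "f (x - real n) = f x" for x
      using periodic_shift_nat[of f "x - real n" n, OF per] by simp
    moreover have "(indicator {0..<real (Suc n)} x :: real)
        = indicator {0..<real n} x + indicator {0..<1} (x - real n)" for x
      by (auto simp: indicator_def)
    ultimately show ?case
      using Suc by (simp only: distrib_right) auto
  qed simp
  have "(\<lambda>x. indicator {0..<real n} x * f x + indicator {real n} x * f (real n)) \<in> borel_measurable lebesgue"
    by (rule borel_measurable_add[OF half borel_measurable_times[OF borel_measurable_indicator]]) auto
  also have "(\<lambda>x. indicator {0..<real n} x * f x + indicator {real n} x * f (real n))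
      = (\<lambda>x. indicator {0..real n} x * f x)"
    by (intro ext) (auto simp: indicator_def)
  finally show ?thesis
    by (simp add: borel_measurable_restrict_space_iff)
qed

lemma has_bochner_integral_half_open:
  fixes h :: "real \<Rightarrow> real"
  assumes "h \<in> borel_measurable (lebesgue_on {0..T})"
  shows "has_bochner_integral (lebesgue_on {0..T}) h I \<longleftrightarrow>
    has_bochner_integral lebesgue (\<lambda>x. indicator {0..<T} x * h x) I"
proof -
  have m: "(\<lambda>x. indicator {0..T} x * h x) \<in> borel_measurable lebesgue"
    using assms by (simp add: borel_measurable_restrict_space_iff)
  have "(\<lambda>x. indicator {0..<T} x * (indicator {0..T} x * h x)) \<in> borel_measurable lebesgue"
    by (rule borel_measurable_times[OF borel_measurable_indicator m]) simp
  also have "(\<lambda>x. indicator {0..<T} x * (indicator {0..T} x * h x)) = (\<lambda>x. indicator {0..<T} x * h x)"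
    by (intro ext) (auto simp: indicator_def)
  finally have m': "(\<lambda>x. indicator {0..<T} x * h x) \<in> borel_measurable lebesgue" .
  have "AE x in lebesgue. x \<noteq> T"
    by (rule AE_I[of _ _ "{T}"]) auto
  then have AE: "AE x in lebesgue. indicator {0..T} x * h x = indicator {0..<T} x * h x"
    by eventually_elim (auto simp: indicator_def)
  have "has_bochner_integral (lebesgue_on {0..T}) h I \<longleftrightarrow>
      has_bochner_integral lebesgue (\<lambda>x. indicator {0..T} x * h x) I"
    by (simp add: has_bochner_integral_restrict_space)
  also have "\<dots> \<longleftrightarrow> has_bochner_integral lebesgue (\<lambda>x. indicator {0..<T} x * h x) I"
    by (rule has_bochner_integral_cong_AE[OF m m' AE])
  finally show ?thesis .
qed

lemma periodic_has_bochner_integral: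
  fixes h :: "real \<Rightarrow> real"
  assumes per: "\<And>t. h (t + 1) = h t" and h: "integrable (lebesgue_on {0..1}) h"
  shows "has_bochner_integral (lebesgue_on {0..real n}) h (real n * (LINT t|lebesgue_on {0..1}. h t))"
proof -
  let ?I = "LINT t|lebesgue_on {0..1}. h t"
  have hm: "h \<in> borel_measurable (lebesgue_on {0..1})"
    using h by auto
  have base: "has_bochner_integral lebesgue (\<lambda>x. indicator {0..<1} x * h x) ?I"
    by (rule has_bochner_integral_half_open[OF hm, THEN iffD1, OF has_bochner_integral_integrable[OF h]])
  have "has_bochner_integral lebesgue (\<lambda>x. indicator {0..<real n} x * h x) (real n * ?I)"
  proof (induction n)
    case (Suc n)
    have "h (x - real n) = h x" for x
      using periodic_shift_nat[of h "x - real n" n, OF per] by simp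
    then have "has_bochner_integral lebesgue (\<lambda>x. indicator {0..<1} (x - real n) * h x) ?I"
      using base has_bochner_integral_lebesgue_real_affine_iff[of 1 "\<lambda>x. indicator {0..<1} x * h x" ?I "- real n"]
      by simp
    from has_bochner_integral_add[OF Suc this]
    have "has_bochner_integral lebesgue
      (\<lambda>x. indicator {0..<real n} x * h x + indicator {0..<1} (x - real n) * h x) (real n * ?I + ?I)" .
    moreover have "(indicator {0..<real (Suc n)} x :: real)
        = indicator {0..<real n} x + indicator {0..<1} (x - real n)" for x
      by (auto simp: indicator_def)
    ultimately show ?case
      by (simp add: distrib_right add.commute)
  qed (simp add: has_bochner_integral_zero)
  then show ?thesis
    using has_bochner_integral_half_open[OF periodic_borel_measurable[of h n, OF per hm]] by simp
qed

lemma periodic_L2_on: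
  assumes "f \<in> periodic_L2"
  shows "f \<in> L2_on (real n)"
proof -
  have per: "\<And>t. f (t + 1) = f t" and f: "f \<in> L2_on 1"
    using assms unfolding periodic_L2_def by blast+
  have f1: "f \<in> borel_measurable (lebesgue_on {0..1})" "integrable (lebesgue_on {0..1}) (\<lambda>t. (f t)\<^sup>2)"
    using f unfolding L2_on_iff by blast+
  have "(f (t + 1))\<^sup>2 = (f t)\<^sup>2" for t
    by (simp only: per)
  from periodic_has_bochner_integral[of "\<lambda>t. (f t)\<^sup>2" n, OF this f1(2)]
  have "integrable (lebesgue_on {0..real n}) (\<lambda>t. (f t)\<^sup>2)"
    unfolding has_bochner_integral_iff by blast
  then show ?thesis
    using periodic_borel_measurable[of f n, OF per f1(1)] unfolding L2_on_iff by blast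
qed

lemma periodic_inner_L2:
  assumes "f \<in> periodic_L2" "g \<in> periodic_L2"
  shows "inner_L2 (real n) f g = real n * inner_L2 1 f g"
  using periodic_has_bochner_integral[of "\<lambda>t. f t * g t" n] assms
    L2_on_integrable_mult[of f 1 g]
  by (simp add: inner_L2_eq has_bochner_integral_iff periodic_L2_def)

lemma norm_L2_diff_orthonormal_sum:
  assumes \<phi>: "orthonormal_basis \<phi>" and S: "S \<in> L2_on 1"
  shows "(norm_L2 1 (\<lambda>t. S t - (\<Sum>j=1..n. a j * \<phi> j t)))\<^sup>2
     = (norm_L2 1 S)\<^sup>2 - (\<Sum>j=1..n. (inner_L2 1 S (\<phi> j))\<^sup>2)
       + (\<Sum>j=1..n. (a j - inner_L2 1 S (\<phi> j))\<^sup>2)"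
proof -
  have \<phi>_L2: "\<phi> j \<in> L2_on 1" if "j \<ge> 1" for j
    using \<phi> that by (auto simp: orthonormal_basis_def periodic_L2_def)
  have on: "inner_L2 1 (\<phi> i) (\<phi> j) = (if i = j then 1 else 0)" if "i \<ge> 1" "j \<ge> 1" for i j
    using \<phi> that by (auto simp: orthonormal_basis_def)
  let ?g = "\<lambda>t. \<Sum>j=1..n. a j * \<phi> j t"
  have scaled: "(\<lambda>t. a j * \<phi> j t) \<in> L2_on 1" if "j \<in> {1..n}" for j
    using that by (intro L2_on_scale \<phi>_L2) auto
  have g: "?g \<in> L2_on 1"
    by (rule L2_on_sum[OF scaled])
  have inner_g: "inner_L2 1 ?g h = (\<Sum>j=1..n. a j * inner_L2 1 (\<phi> j) h)" if "h \<in> L2_on 1" for h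
    using inner_L2_sum_left[of "{1..n}" "\<lambda>j t. a j * \<phi> j t" 1 h, OF scaled that]
    by (simp only: inner_L2_scale_left)
  have 1: "inner_L2 1 S ?g = (\<Sum>j=1..n. a j * inner_L2 1 S (\<phi> j))"
    using inner_g[OF S] by (simp add: inner_L2_commute[of 1 S])
  have "inner_L2 1 (\<phi> j) ?g = a j" if "j \<in> {1..n}" for j
  proof -
    have "inner_L2 1 ?g (\<phi> j) = (\<Sum>i=1..n. a i * (if i = j then 1 else 0))"
      unfolding inner_g[OF \<phi>_L2, of j, OF atLeastAtMost_iff[THEN iffD1, OF that, THEN conjunct1]]
      by (intro sum.cong refl) (use on that in auto)
    also have "\<dots> = a j" using that by (simp add: if_distrib cong: if_cong)
    finally show ?thesis by (simp add: inner_L2_commute)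
  qed
  then have 2: "(norm_L2 1 ?g)\<^sup>2 = (\<Sum>j=1..n. (a j)\<^sup>2)"
    unfolding norm_L2_square inner_g[OF g] by (simp add: power2_eq_square)
  have "(\<Sum>j=1..n. (a j - inner_L2 1 S (\<phi> j))\<^sup>2)
      = (\<Sum>j=1..n. (a j)\<^sup>2) + (\<Sum>j=1..n. (inner_L2 1 S (\<phi> j))\<^sup>2)
        - 2 * (\<Sum>j=1..n. a j * inner_L2 1 S (\<phi> j))"
    by (simp add: power2_diff sum.distrib sum_subtractf sum_distrib_left mult.assoc)
  then show ?thesis
    unfolding norm_L2_diff_square[OF S g] 1 2 by simp
qed

lemma Parseval:
  assumes \<phi>: "orthonormal_basis \<phi>" and S: "S \<in> periodic_L2"
  shows "(\<lambda>j. (inner_L2 1 S (\<phi> (Suc j)))\<^sup>2) sums (norm_L2 1 S)\<^sup>2"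
proof -
  let ?s = "\<lambda>j. (inner_L2 1 S (\<phi> j))\<^sup>2"
  have S1: "S \<in> L2_on 1" using S by (simp add: periodic_L2_def)
  note eq = norm_L2_diff_orthonormal_sum[OF \<phi> S1]
  have Bessel: "(\<Sum>j=1..n. ?s j) \<le> (norm_L2 1 S)\<^sup>2" for n
  proof -
    have "0 \<le> (norm_L2 1 S)\<^sup>2 - (\<Sum>j=1..n. ?s j)"
      using eq[where n=n and a="\<lambda>j. inner_L2 1 S (\<phi> j)"]
        zero_le_power2[of "norm_L2 1 (\<lambda>t. S t - (\<Sum>j=1..n. inner_L2 1 S (\<phi> j) * \<phi> j t))"]
      by simp
    then show ?thesis by simp
  qed
  have ss: "(\<Sum>j<n. ?s (Suc j)) = (\<Sum>j=1..n. ?s j)" for n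
    by (induction n) auto
  have "(\<lambda>n. \<Sum>j<n. ?s (Suc j)) \<longlonglongrightarrow> (norm_L2 1 S)\<^sup>2"
  proof (rule LIMSEQ_I)
    fix e :: real assume e: "0 < e"
    have "\<forall>\<epsilon>>0. \<exists>N c. norm_L2 1 (\<lambda>t. S t - (\<Sum>j=1..N. c j * \<phi> j t)) < \<epsilon>"
      using \<phi> S unfolding orthonormal_basis_def by blast
    then obtain N c where N: "norm_L2 1 (\<lambda>t. S t - (\<Sum>j=1..N. c j * \<phi> j t)) < sqrt e"
      using real_sqrt_gt_zero[OF e] by blast
    have "(norm_L2 1 (\<lambda>t. S t - (\<Sum>j=1..N. c j * \<phi> j t)))\<^sup>2 < (sqrt e)\<^sup>2"
      by (rule power_strict_mono[OF N norm_L2_nonneg]) simp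
    then have "(norm_L2 1 S)\<^sup>2 - (\<Sum>j=1..N. ?s j) < e"
      using eq[where n=N and a=c] e sum_nonneg[of "{1..N}" "\<lambda>j. (c j - inner_L2 1 S (\<phi> j))\<^sup>2"] by simp
    moreover have "(\<Sum>j=1..N. ?s j) \<le> (\<Sum>j=1..n. ?s j)" if "n \<ge> N" for n
      using that by (intro sum_mono2) auto
    ultimately have "norm ((\<Sum>j<n. ?s (Suc j)) - (norm_L2 1 S)\<^sup>2) < e" if "n \<ge> N" for n
      using that Bessel[of n] unfolding ss by fastforce
    then show "\<exists>no. \<forall>n\<ge>no. norm ((\<Sum>j<n. ?s (Suc j)) - (norm_L2 1 S)\<^sup>2) < e" by blast
  qed
  then show ?thesis by (simp add: sums_def)
qed

lemma summable_tail_energy: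
  assumes "orthonormal_basis \<phi>" "S \<in> periodic_L2"
  shows "summable (\<lambda>i. (inner_L2 1 S (\<phi> (Suc n + i)))\<^sup>2)"
  using summable_ignore_initial_segment[OF sums_summable[OF Parseval[OF assms]], of n]
  by (simp add: add.commute)

lemma norm_L2_eq_tail_energy:
  assumes "orthonormal_basis \<phi>" "S \<in> periodic_L2"
  shows "(norm_L2 1 S)\<^sup>2 = (\<Sum>j=1..n. (inner_L2 1 S (\<phi> j))\<^sup>2) + tail_energy \<phi> S (Suc n)"
proof -
  let ?s = "\<lambda>j. (inner_L2 1 S (\<phi> j))\<^sup>2"
  note P = Parseval[OF assms]
  have "(norm_L2 1 S)\<^sup>2 = (\<Sum>j. ?s (Suc j))"
    using P by (simp add: sums_iff)
  also have "\<dots> = (\<Sum>i. ?s (Suc (i + n))) + (\<Sum>j<n. ?s (Suc j))"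
    by (rule suminf_split_initial_segment[OF sums_summable[OF P]])
  also have "(\<Sum>j<n. ?s (Suc j)) = (\<Sum>j=1..n. ?s j)"
    by (induction n) auto
  also have "(\<Sum>i. ?s (Suc (i + n))) = tail_energy \<phi> S (Suc n)"
    by (simp add: tail_energy_def add.commute)
  finally show ?thesis by simp
qed

lemma tail_energy_nonneg:
  assumes "orthonormal_basis \<phi>" "S \<in> periodic_L2"
  shows "0 \<le> tail_energy \<phi> S (Suc n)"
  unfolding tail_energy_def by (rule suminf_nonneg[OF summable_tail_energy[OF assms]]) simp

lemma projection_error:
  assumes "orthonormal_basis \<phi>" "S \<in> periodic_L2"
  shows "(norm_L2 1 (\<lambda>t. (\<Sum>j=1..n. a j * \<phi> j t) - S t))\<^sup>2
    = (\<Sum>j=1..n. (a j - inner_L2 1 S (\<phi> j))\<^sup>2) + tail_energy \<phi> S (Suc n)"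
proof -
  have S1: "S \<in> L2_on 1" using assms by (simp add: periodic_L2_def)
  have "(norm_L2 1 (\<lambda>t. (\<Sum>j=1..n. a j * \<phi> j t) - S t))\<^sup>2
      = (norm_L2 1 (\<lambda>t. S t - (\<Sum>j=1..n. a j * \<phi> j t)))\<^sup>2"
    unfolding norm_L2_def inner_L2_def by (simp add: algebra_simps)
  then show ?thesis
    using norm_L2_diff_orthonormal_sum[OF assms(1) S1, where n=n and a=a] norm_L2_eq_tail_energy[OF assms, of n]
    by simp
qed

section \<open>Stochastic integrals under a shift of the path\<close>

lemma space_path_space: "space path_space = {w \<in> extensional {0..}. continuous_on {0..} w}"
  by (auto simp: path_space_def space_restrict_space space_PiM PiE_def)

lemma component_path_space_measurable [measurable]:
  "0 \<le> t \<Longrightarrow> (\<lambda>w. w t) \<in> borel_measurable path_space"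
  unfolding path_space_def by (rule measurable_restrict_space1) measurable

lemma space_history: "space (history T) = space path_space"
  by (simp add: history_def)

lemma component_history_measurable:
  assumes "t \<in> {0..T}"
  shows "(\<lambda>w. w t) \<in> borel_measurable (history T)"
proof -
  have "(\<lambda>w. restrict w {0..T}) \<in> history T \<rightarrow>\<^sub>M PiM {0..T} (\<lambda>_. borel)"
    unfolding history_def by (rule measurable_vimage_algebra1) (auto simp: space_PiM)
  from measurable_compose[OF this measurable_component_singleton[OF assms]]
  show ?thesis using assms by simp
qed

lemma history_le_path_space: "sets (history T) \<subseteq> sets path_space"
proof -
  have "(\<lambda>w. restrict w {0..T}) \<in> path_space \<rightarrow>\<^sub>M PiM {0..T} (\<lambda>_. borel)"
    by (rule measurable_restrict) auto
  then show ?thesis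
    by (auto simp: history_def sets_vimage_algebra2 measurable_def space_PiM elim!: measurable_sets)
qed

lemma history_measurable_path_law:
  assumes "J \<in> borel_measurable (history T)" "sets M = sets path_space"
  shows "J \<in> borel_measurable M"
  using assms history_le_path_space[of T] sets_eq_imp_space_eq[OF assms(2)]
  by (auto simp: measurable_def space_history)

lemma set_integrable_continuous:
  fixes S :: "real \<Rightarrow> real"
  assumes "continuous_on UNIV S"
  shows "set_integrable lebesgue {a..b} S"
  using borel_integrable_compact[of "{a..b}" S] continuous_on_subset[OF assms]
  by (auto simp: set_integrable_def integrable_completion borel_measurable_integrable)

lemma continuous_on_indefinite_integral:
  fixes S :: "real \<Rightarrow> real"
  assumes S: "continuous_on UNIV S"
  shows "continuous_on {0..} (\<lambda>t. LINT s:{0..t}|lebesgue. S s)"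
  unfolding continuous_on_eq_continuous_within
proof
  fix x :: real assume x: "x \<in> {0..}"
  have eq: "(LINT s:{0..t}|lebesgue. S s) = integral {0..t} S" for t
    by (rule set_lebesgue_integral_eq_integral[OF set_integrable_continuous[OF S]])
  have "continuous_on {0..x+1} (\<lambda>t. integral {0..t} S)"
    by (intro indefinite_integral_continuous_1 integrable_continuous_real continuous_on_subset[OF S]) auto
  then have "continuous (at x within {0..x+1}) (\<lambda>t. integral {0..t} S)"
    using x by (auto simp: continuous_on_eq_continuous_within)
  moreover have "at x within {0..} = at x within {0..x+1}"
    by (rule at_within_nhd[of _ "{..<x+1}"]) auto
  ultimately show "continuous (at x within {0..}) (\<lambda>t. LINT s:{0..t}|lebesgue. S s)"
    by (simp add: eq)
qed

lemma observe_in_path_space: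
  assumes "continuous_on UNIV S" "w \<in> space path_space"
  shows "observe S w \<in> space path_space"
proof -
  have "continuous_on {0..} (\<lambda>t. (LINT s:{0..t}|lebesgue. S s) + w t)"
    using assms by (intro continuous_on_add continuous_on_indefinite_integral) (auto simp: space_path_space)
  then have "continuous_on {0..} (observe S w)"
    by (rule continuous_on_eq) (simp add: observe_def)
  then show ?thesis
    by (simp add: space_path_space observe_def)
qed

lemma observe_measurable:
  assumes "continuous_on UNIV S"
  shows "observe S \<in> path_space \<rightarrow>\<^sub>M path_space"
proof -
  have "observe S \<in> path_space \<rightarrow>\<^sub>M PiM {0..} (\<lambda>_. borel)"
    unfolding observe_def[abs_def] by (rule measurable_restrict) auto
  then have "observe S \<in> path_space \<rightarrow>\<^sub>M restrict_space (PiM {0..} (\<lambda>_. borel)) {w. continuous_on {0..} w}"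
    by (rule measurable_restrict_space2[rotated])
      (use observe_in_path_space[OF assms] in \<open>auto simp: space_path_space\<close>)
  then show ?thesis by (simp add: path_space_def)
qed

lemma observe_history_measurable:
  assumes "continuous_on UNIV S"
  shows "observe S \<in> history T \<rightarrow>\<^sub>M history T"
  unfolding history_def[of T]
proof (rule measurable_vimage_algebra2)
  show "observe S \<in> space (vimage_algebra (space path_space) (\<lambda>w. restrict w {0..T}) (PiM {0..T} (\<lambda>_. borel))) \<rightarrow> space path_space"
    using observe_in_path_space[OF assms] by auto
  have "(\<lambda>w. \<lambda>t\<in>{0..T}. (LINT s:{0..t}|lebesgue. S s) + w t) \<in> history T \<rightarrow>\<^sub>M PiM {0..T} (\<lambda>_. borel)"
    by (rule measurable_restrict) (auto intro!: borel_measurable_add component_history_measurable)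
  moreover have "(\<lambda>t\<in>{0..T}. (LINT s:{0..t}|lebesgue. S s) + w t) = restrict (observe S w) {0..T}" for w
    by (auto simp: observe_def)
  ultimately show "(\<lambda>w. restrict (observe S w) {0..T})
      \<in> vimage_algebra (space path_space) (\<lambda>w. restrict w {0..T}) (PiM {0..T} (\<lambda>_. borel)) \<rightarrow>\<^sub>M PiM {0..T} (\<lambda>_. borel)"
    by (simp add: history_def)
qed

lemma observe_uminus_cancel:
  assumes "w \<in> space path_space"
  shows "observe (\<lambda>s. - S s) (observe S w) = w"
proof
  fix t show "observe (\<lambda>s. - S s) (observe S w) t = w t"
    using assms by (cases "0 \<le> t")
      (auto simp: observe_def space_path_space extensional_def set_lebesgue_integral_def)
qed

lemma partition_of_mem:
  assumes "partition_of T k t" "i \<le> k"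
  shows "0 \<le> t i" "t i \<le> T"
proof -
  have "t 0 \<le> t i" "t i \<le> t k"
    using assms by (auto simp: partition_of_def mono_on_def)
  then show "0 \<le> t i" "t i \<le> T"
    using assms by (auto simp: partition_of_def)
qed

lemma step_integral_observe:
  assumes S: "continuous_on UNIV S" and part: "partition_of T k t"
  shows "step_integral k t c (observe S w) = step_integral k t c w + inner_L2 T (step_fun k t c) S"
proof -
  let ?F = "\<lambda>b. LINT s:{0..b}|lebesgue. S s"
  have int: "set_integrable lebesgue {0..b} S" for b
    by (rule set_integrable_continuous[OF S])
  have piece: "(LINT x|lebesgue. indicator {0..T} x * (c i * indicator {t i<..t (Suc i)} x * S x))
      = c i * (?F (t (Suc i)) - ?F (t i))"
    and piece_int: "integrable lebesgue (\<lambda>x. indicator {0..T} x * (c i * indicator {t i<..t (Suc i)} x * S x))"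
    if "i < k" for i
  proof -
    have *: "0 \<le> t i" "t i \<le> t (Suc i)" "t (Suc i) \<le> T"
      using part that partition_of_mem[OF part, of i] partition_of_mem[OF part, of "Suc i"]
      by (auto simp: partition_of_def mono_on_def)
    have eq: "indicator {0..T} x * (c i * indicator {t i<..t (Suc i)} x * S x)
        = c i * (indicator {0..t (Suc i)} x * S x - indicator {0..t i} x * S x)" for x
      using * by (auto simp: indicator_def)
    show "(LINT x|lebesgue. indicator {0..T} x * (c i * indicator {t i<..t (Suc i)} x * S x))
      = c i * (?F (t (Suc i)) - ?F (t i))"
      unfolding eq using int[of "t (Suc i)"] int[of "t i"]
      by (simp add: set_integrable_def set_lebesgue_integral_def)
    show "integrable lebesgue (\<lambda>x. indicator {0..T} x * (c i * indicator {t i<..t (Suc i)} x * S x))"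
      unfolding eq using int[of "t (Suc i)"] int[of "t i"]
      by (auto simp: set_integrable_def)
  qed
  have "inner_L2 T (step_fun k t c) S
      = (LINT x|lebesgue. (\<Sum>i<k. indicator {0..T} x * (c i * indicator {t i<..t (Suc i)} x * S x)))"
    by (simp only: inner_L2_def set_lebesgue_integral_def step_fun_def sum_distrib_left
        sum_distrib_right real_scaleR_def)
  also have "\<dots> = (\<Sum>i<k. c i * (?F (t (Suc i)) - ?F (t i)))"
    using piece_int by (subst Bochner_Integration.integral_sum) (auto simp: piece)
  finally have inner: "inner_L2 T (step_fun k t c) S = (\<Sum>i<k. c i * (?F (t (Suc i)) - ?F (t i)))" .
  have "step_integral k t c (observe S w)
      = (\<Sum>i<k. c i * (w (t (Suc i)) - w (t i)) + c i * (?F (t (Suc i)) - ?F (t i)))"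
    unfolding step_integral_def
  proof (intro sum.cong refl)
    fix i assume "i \<in> {..<k}"
    then have "0 \<le> t i" "0 \<le> t (Suc i)"
      using partition_of_mem(1)[OF part] by auto
    then show "c i * (observe S w (t (Suc i)) - observe S w (t i))
        = c i * (w (t (Suc i)) - w (t i)) + c i * (?F (t (Suc i)) - ?F (t i))"
      by (simp add: observe_def algebra_simps)
  qed
  then show ?thesis
    by (simp add: inner step_integral_def sum.distrib)
qed

lemma step_integral_measurable:
  assumes "partition_of T k t" "sets M = sets path_space"
  shows "step_integral k t c \<in> borel_measurable M"
proof -
  have "step_integral k t c \<in> borel_measurable path_space"
    unfolding step_integral_def[abs_def]
    using partition_of_mem(1)[OF assms(1)]
    by (intro borel_measurable_sum borel_measurable_times borel_measurable_diff) auto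
  then show ?thesis
    using assms(2) by (simp cong: measurable_cong_sets)
qed

lemma has_stoch_integral_approx:
  assumes "has_stoch_integral M T f J" "\<epsilon> > 0"
  obtains \<delta> where "\<delta> > 0"
    and "\<And>k t c. partition_of T k t \<Longrightarrow> norm_L2 T (\<lambda>x. step_fun k t c x - f x) < \<delta> \<Longrightarrow>
        measure M {w \<in> space M. \<bar>step_integral k t c w - J w\<bar> > \<epsilon>} < \<epsilon>"
proof -
  have "\<exists>\<delta>>0. \<forall>k t c. partition_of T k t \<and> norm_L2 T (\<lambda>x. step_fun k t c x - f x) < \<delta> \<longrightarrow>
      measure M {w \<in> space M. \<bar>step_integral k t c w - J w\<bar> > \<epsilon>} < \<epsilon>"
    using assms unfolding has_stoch_integral_def by simp
  then obtain \<delta> where "\<delta> > 0" and *: "\<forall>k t c. partition_of T k t \<and> norm_L2 T (\<lambda>x. step_fun k t c x - f x) < \<delta> \<longrightarrow>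
      measure M {w \<in> space M. \<bar>step_integral k t c w - J w\<bar> > \<epsilon>} < \<epsilon>"
    by (elim exE conjE)
  show thesis
    by (rule that[OF \<open>\<delta> > 0\<close>]) (rule *[rule_format], rule conjI)
qed

lemma has_stoch_integral_unique:
  assumes M: "path_law M" and T: "0 < T" and f: "f \<in> L2_on T"
    and J: "has_stoch_integral M T f J" and J': "has_stoch_integral M T f J'"
  shows "AE w in M. J w = J' w"
proof -
  interpret prob_space M using M by (simp add: path_law_def)
  have sets: "sets M = sets path_space" using M by (simp add: path_law_def)
  have [measurable]: "J \<in> borel_measurable M" "J' \<in> borel_measurable M"
    using J J' history_measurable_path_law[OF _ sets] by (auto simp: has_stoch_integral_def)
  have small: "measure M {w \<in> space M. \<bar>J w - J' w\<bar> > 2 * \<epsilon>} \<le> 2 * \<epsilon>" if \<epsilon>: "\<epsilon> > 0" for \<epsilon>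
  proof -
    obtain \<delta> where "\<delta> > 0" and \<delta>: "\<And>k t c. partition_of T k t \<Longrightarrow> norm_L2 T (\<lambda>x. step_fun k t c x - f x) < \<delta> \<Longrightarrow>
        measure M {w \<in> space M. \<bar>step_integral k t c w - J w\<bar> > \<epsilon>} < \<epsilon>"
      by (rule has_stoch_integral_approx[OF J \<epsilon>]) (rule that)
    obtain \<delta>' where "\<delta>' > 0" and \<delta>': "\<And>k t c. partition_of T k t \<Longrightarrow> norm_L2 T (\<lambda>x. step_fun k t c x - f x) < \<delta>' \<Longrightarrow>
        measure M {w \<in> space M. \<bar>step_integral k t c w - J' w\<bar> > \<epsilon>} < \<epsilon>"
      by (rule has_stoch_integral_approx[OF J' \<epsilon>]) (rule that)
    obtain k t c where part: "partition_of T k t"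
      and close: "norm_L2 T (\<lambda>x. step_fun k t c x - f x) < min \<delta> \<delta>'"
      using step_fun_dense[OF T f, of "min \<delta> \<delta>'"] \<open>\<delta> > 0\<close> \<open>\<delta>' > 0\<close> by auto
    note [measurable] = step_integral_measurable[OF part sets, of c]
    let ?A = "{w \<in> space M. \<bar>step_integral k t c w - J w\<bar> > \<epsilon>}"
    let ?B = "{w \<in> space M. \<bar>step_integral k t c w - J' w\<bar> > \<epsilon>}"
    have "measure M {w \<in> space M. \<bar>J w - J' w\<bar> > 2 * \<epsilon>} \<le> measure M (?A \<union> ?B)"
      by (rule finite_measure_mono) auto
    also have "\<dots> \<le> measure M ?A + measure M ?B"
      by (rule measure_Un_le) auto
    also have "\<dots> \<le> 2 * \<epsilon>"
    proof -
      have "measure M ?A < \<epsilon>" "measure M ?B < \<epsilon>"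
        by (rule \<delta>[OF part], use close in simp, rule \<delta>'[OF part], use close in simp)
      then show ?thesis by simp
    qed
    finally show ?thesis .
  qed
  have null: "measure M {w \<in> space M. \<bar>J w - J' w\<bar> > \<epsilon>} = 0" if "\<epsilon> > 0" for \<epsilon>
  proof (rule antisym)
    show "measure M {w \<in> space M. \<bar>J w - J' w\<bar> > \<epsilon>} \<le> 0"
    proof (rule field_le_epsilon)
      fix e :: real assume "0 < e"
      let ?m = "min (e/2) (\<epsilon>/2)"
      have "measure M {w \<in> space M. \<bar>J w - J' w\<bar> > \<epsilon>} \<le> measure M {w \<in> space M. \<bar>J w - J' w\<bar> > 2 * ?m}"
        by (rule finite_measure_mono) auto
      also have "\<dots> \<le> 2 * ?m"
        by (rule small) (use \<open>0 < e\<close> that in auto)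
      finally show "measure M {w \<in> space M. \<bar>J w - J' w\<bar> > \<epsilon>} \<le> 0 + e"
        by simp
    qed
  qed simp
  have "AE w in M. \<not> \<bar>J w - J' w\<bar> > inverse (real (Suc n))" for n
    using null[of "inverse (real (Suc n))"]
    by (subst AE_iff_measurable[OF _ refl]) (auto simp: emeasure_eq_measure)
  then have "AE w in M. \<forall>n. \<not> \<bar>J w - J' w\<bar> > inverse (real (Suc n))"
    by (simp add: AE_all_countable)
  then show ?thesis
  proof eventually_elim
    fix w assume *: "\<forall>n. \<not> \<bar>J w - J' w\<bar> > inverse (real (Suc n))"
    show "J w = J' w"
    proof (rule ccontr)
      assume "J w \<noteq> J' w"
      then obtain n where "inverse (real (Suc n)) < \<bar>J w - J' w\<bar>"
        using reals_Archimedean[of "\<bar>J w - J' w\<bar>"] by auto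
      with * show False by blast
    qed
  qed
qed

lemma path_law_obs_law:
  assumes "path_law Q" "continuous_on UNIV S"
  shows "path_law (obs_law S Q)"
proof -
  have "observe S \<in> Q \<rightarrow>\<^sub>M path_space"
    using observe_measurable[OF assms(2)] assms(1) by (simp add: path_law_def cong: measurable_cong_sets)
  then show ?thesis
    using assms(1) by (auto simp: path_law_def obs_law_def intro: prob_space.prob_space_distr)
qed

lemma has_stoch_integral_obs_law:
  assumes Q: "path_law Q" and S: "continuous_on UNIV S" and f: "f \<in> L2_on T"
    and J: "has_stoch_integral Q T f J"
  shows "has_stoch_integral (obs_law S Q) T f (\<lambda>y. J (observe (\<lambda>s. - S s) y) + inner_L2 T f S)"
    (is "has_stoch_integral _ _ _ ?J")
proof -
  interpret prob_space Q using Q by (simp add: path_law_def)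
  have sets: "sets Q = sets path_space" using Q by (simp add: path_law_def)
  have space: "space Q = space path_space" by (rule sets_eq_imp_space_eq[OF sets])
  have S': "continuous_on UNIV (\<lambda>s. - S s)" using S by (intro continuous_intros)
  have S_L2: "S \<in> L2_on T" by (intro continuous_L2_on continuous_on_subset[OF S]) auto
  have obs_m: "observe S \<in> Q \<rightarrow>\<^sub>M path_space"
    using observe_measurable[OF S] sets by (simp cong: measurable_cong_sets)
  have Jm: "?J \<in> borel_measurable (history T)"
    using measurable_compose[OF observe_history_measurable[OF S', of T], of J borel] J
    by (intro borel_measurable_add) (auto simp: has_stoch_integral_def)
  have law: "sets (obs_law S Q) = sets path_space" by (simp add: obs_law_def)
  have Jm': "?J \<in> borel_measurable (obs_law S Q)" "J \<in> borel_measurable Q"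
    using Jm J law sets by (auto intro: history_measurable_path_law simp: has_stoch_integral_def)
  show ?thesis unfolding has_stoch_integral_def
  proof (intro conjI allI impI Jm)
    fix \<epsilon> :: real assume \<epsilon>: "\<epsilon> > 0"
    obtain \<delta> where "\<delta> > 0" and \<delta>: "\<And>k t c. partition_of T k t \<Longrightarrow> norm_L2 T (\<lambda>x. step_fun k t c x - f x) < \<delta> \<Longrightarrow>
        measure Q {w \<in> space Q. \<bar>step_integral k t c w - J w\<bar> > \<epsilon> / 2} < \<epsilon> / 2"
      by (rule has_stoch_integral_approx[OF J half_gt_zero[OF \<epsilon>]]) (rule that)
    define \<delta>' where "\<delta>' = min \<delta> (\<epsilon> / (2 * (norm_L2 T S + 1)))"
    have nS: "norm_L2 T S + 1 > 0" using norm_L2_nonneg[of T S] by simp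
    have "\<delta>' > 0" using \<open>\<delta> > 0\<close> \<epsilon> nS by (simp add: \<delta>'_def)
    moreover have "measure (obs_law S Q) {w \<in> space (obs_law S Q). \<bar>step_integral k t c w - ?J w\<bar> > \<epsilon>} < \<epsilon>"
      if part: "partition_of T k t" and close: "norm_L2 T (\<lambda>x. step_fun k t c x - f x) < \<delta>'" for k t c
    proof -
      note [measurable] = step_integral_measurable[OF part sets, of c] Jm'
        step_integral_measurable[OF part law, of c]
      let ?d = "inner_L2 T (\<lambda>x. step_fun k t c x - f x) S"
      have "\<bar>?d\<bar> \<le> norm_L2 T (\<lambda>x. step_fun k t c x - f x) * norm_L2 T S"
        by (rule inner_L2_Cauchy_Schwarz[OF L2_on_diff[OF step_fun_L2_on f] S_L2])
      also have "\<dots> \<le> \<epsilon> / (2 * (norm_L2 T S + 1)) * (norm_L2 T S + 1)"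
        using close norm_L2_nonneg[of T S] norm_L2_nonneg[of T "\<lambda>x. step_fun k t c x - f x"] \<epsilon>
        by (intro mult_mono) (auto simp: \<delta>'_def)
      also have "\<dots> = \<epsilon> / 2" using nS by (simp add: field_simps)
      finally have d: "\<bar>?d\<bar> \<le> \<epsilon> / 2" .
      have d_eq: "?d = inner_L2 T (step_fun k t c) S - inner_L2 T f S"
        by (rule inner_L2_diff_left[OF step_fun_L2_on f S_L2])
      have "{w \<in> space (obs_law S Q). \<bar>step_integral k t c w - ?J w\<bar> > \<epsilon>} \<in> sets (obs_law S Q)"
        by measurable
      then have "measure (obs_law S Q) {w \<in> space (obs_law S Q). \<bar>step_integral k t c w - ?J w\<bar> > \<epsilon>}
          = measure Q (observe S -` {w \<in> space (obs_law S Q). \<bar>step_integral k t c w - ?J w\<bar> > \<epsilon>} \<inter> space Q)"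
        unfolding obs_law_def using obs_m by (intro measure_distr) auto
      also have "\<dots> \<le> measure Q {w \<in> space Q. \<bar>step_integral k t c w - J w\<bar> > \<epsilon> / 2}"
      proof (rule finite_measure_mono, rule subsetI)
        fix w assume "w \<in> observe S -` {w \<in> space (obs_law S Q). \<bar>step_integral k t c w - ?J w\<bar> > \<epsilon>} \<inter> space Q"
        then have w: "w \<in> space Q" "\<bar>step_integral k t c (observe S w) - ?J (observe S w)\<bar> > \<epsilon>"
          by auto
        then have "\<bar>step_integral k t c w - J w + ?d\<bar> > \<epsilon>"
          using observe_uminus_cancel[of w S] unfolding space
          by (simp add: step_integral_observe[OF S part] d_eq algebra_simps)
        then have "\<bar>step_integral k t c w - J w\<bar> > \<epsilon> / 2"
          using d by linarith
        with w(1) show "w \<in> {w \<in> space Q. \<bar>step_integral k t c w - J w\<bar> > \<epsilon> / 2}"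
          by blast
      qed measurable
      also have "\<dots> < \<epsilon> / 2"
        using \<delta>[OF part] close by (simp add: \<delta>'_def)
      finally show ?thesis using \<epsilon> by simp
    qed
    ultimately show "\<exists>\<delta>>0. \<forall>k t c. partition_of T k t \<and> norm_L2 T (\<lambda>x. step_fun k t c x - f x) < \<delta> \<longrightarrow>
        measure (obs_law S Q) {w \<in> space (obs_law S Q). \<bar>step_integral k t c w - ?J w\<bar> > \<epsilon>} < \<epsilon>"
      by blast
  qed
qed

lemma has_stoch_integral_stoch_integral:
  assumes "\<exists>J. has_stoch_integral M T f J"
  shows "has_stoch_integral M T f (stoch_integral M T f)"
  unfolding stoch_integral_def using assms by (rule someI_ex)

lemma stoch_integral_obs_law:
  assumes Q: "path_law Q" and S: "continuous_on UNIV S" and T: "0 < T" and f: "f \<in> L2_on T"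
    and ex: "\<exists>J. has_stoch_integral Q T f J"
  shows "AE y in obs_law S Q. stoch_integral (obs_law S Q) T f y
    = stoch_integral Q T f (observe (\<lambda>s. - S s) y) + inner_L2 T f S"
proof -
  note J = has_stoch_integral_obs_law[OF Q S f has_stoch_integral_stoch_integral[OF ex]]
  then have "has_stoch_integral (obs_law S Q) T f (stoch_integral (obs_law S Q) T f)"
    by (intro has_stoch_integral_stoch_integral) blast
  then show ?thesis
    by (rule has_stoch_integral_unique[OF path_law_obs_law[OF Q S] T f _ J])
qed

section \<open>The largest eigenvalue of a symmetric matrix\<close>

unbundle no inner_syntax

lemma scalar_prod_Cauchy_Schwarz:
  fixes v w :: "real Matrix.vec"
  assumes "v \<in> carrier_vec n" "w \<in> carrier_vec n"
  shows "(v \<bullet> w)\<^sup>2 \<le> (v \<bullet> v) * (w \<bullet> w)"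
  using Cauchy_Schwarz_ineq_sum[of "\<lambda>i. v $ i" "\<lambda>i. w $ i" "{0..<n}"] assms
  by (simp add: scalar_prod_def power2_eq_square)

lemma scalar_prod_self_nonneg: "0 \<le> (v :: real Matrix.vec) \<bullet> v"
  by (simp add: scalar_prod_def sum_nonneg)

lemma mult_mat_vec_bounded:
  fixes A :: "real Matrix.mat"
  assumes A: "A \<in> carrier_mat n n"
  shows "\<exists>K>0. \<forall>v\<in>carrier_vec n. (A *\<^sub>v v) \<bullet> (A *\<^sub>v v) \<le> K * (v \<bullet> v)"
proof (intro exI conjI ballI)
  let ?K = "(\<Sum>i<n. Matrix.row A i \<bullet> Matrix.row A i) + 1"
  show "?K > 0"
    using sum_nonneg[of "{..<n}" "\<lambda>i. Matrix.row A i \<bullet> Matrix.row A i"] scalar_prod_self_nonneg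
    by (simp add: add_nonneg_pos)
  fix v :: "real Matrix.vec" assume v: "v \<in> carrier_vec n"
  have "(A *\<^sub>v v) \<bullet> (A *\<^sub>v v) = (\<Sum>i<n. (Matrix.row A i \<bullet> v)\<^sup>2)"
    using A by (simp add: scalar_prod_def[of "A *\<^sub>v v"] power2_eq_square lessThan_atLeast0)
  also have "\<dots> \<le> (\<Sum>i<n. (Matrix.row A i \<bullet> Matrix.row A i) * (v \<bullet> v))"
    by (intro sum_mono scalar_prod_Cauchy_Schwarz[OF _ v]) (use A in auto)
  also have "\<dots> \<le> ?K * (v \<bullet> v)"
    using scalar_prod_self_nonneg[of v] by (simp add: sum_distrib_right[symmetric] distrib_right)
  finally show "(A *\<^sub>v v) \<bullet> (A *\<^sub>v v) \<le> ?K * (v \<bullet> v)" .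
qed

lemma psd_mult_mat_vec_bounded:
  fixes A :: "real Matrix.mat"
  assumes A: "A \<in> carrier_mat n n"
    and sym: "\<And>v w. v \<in> carrier_vec n \<Longrightarrow> w \<in> carrier_vec n \<Longrightarrow> v \<bullet> (A *\<^sub>v w) = w \<bullet> (A *\<^sub>v v)"
    and psd: "\<And>v. v \<in> carrier_vec n \<Longrightarrow> 0 \<le> v \<bullet> (A *\<^sub>v v)"
  shows "\<exists>L>0. \<forall>v\<in>carrier_vec n. (A *\<^sub>v v) \<bullet> (A *\<^sub>v v) \<le> L * (v \<bullet> (A *\<^sub>v v))"
proof -
  obtain K where K: "K > 0" "\<And>v. v \<in> carrier_vec n \<Longrightarrow> (A *\<^sub>v v) \<bullet> (A *\<^sub>v v) \<le> K * (v \<bullet> v)"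
    using mult_mat_vec_bounded[OF A] by blast
  define L where "L = sqrt K + 1"
  have "L > 0" using K(1) by (simp add: L_def add_pos_pos)
  have quad: "v \<bullet> (A *\<^sub>v v) \<le> sqrt K * (v \<bullet> v)" if v: "v \<in> carrier_vec n" for v
  proof (rule power2_le_imp_le)
    have Av: "A *\<^sub>v v \<in> carrier_vec n" using A v by auto
    have "(v \<bullet> (A *\<^sub>v v))\<^sup>2 \<le> (v \<bullet> v) * ((A *\<^sub>v v) \<bullet> (A *\<^sub>v v))"
      by (rule scalar_prod_Cauchy_Schwarz[OF v Av])
    also have "\<dots> \<le> (v \<bullet> v) * (K * (v \<bullet> v))"
      by (intro mult_left_mono K v scalar_prod_self_nonneg)
    finally show "(v \<bullet> (A *\<^sub>v v))\<^sup>2 \<le> (sqrt K * (v \<bullet> v))\<^sup>2"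
      using K(1) by (simp add: power_mult_distrib) (simp add: power2_eq_square mult_ac)
    show "0 \<le> sqrt K * (v \<bullet> v)"
      using K(1) scalar_prod_self_nonneg by simp
  qed
  have "(A *\<^sub>v v) \<bullet> (A *\<^sub>v v) \<le> L * (v \<bullet> (A *\<^sub>v v))" if v: "v \<in> carrier_vec n" for v
  proof -
    define w where "w = A *\<^sub>v v"
    have w: "w \<in> carrier_vec n" using A v by (auto simp: w_def)
    have Aw: "A *\<^sub>v w \<in> carrier_vec n" using A w by auto
    have "0 \<le> v \<bullet> w - 2 * (x * (w \<bullet> w)) + x\<^sup>2 * (w \<bullet> (A *\<^sub>v w))" for x
    proof -
      let ?z = "v - x \<cdot>\<^sub>v w"
      have xw: "x \<cdot>\<^sub>v w \<in> carrier_vec n" using w by auto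
      have Az: "A *\<^sub>v ?z = w - x \<cdot>\<^sub>v (A *\<^sub>v w)"
        by (simp only: mult_minus_distrib_mat_vec[OF A v xw] mult_mat_vec[OF A w] w_def[symmetric])
      have "?z \<bullet> (A *\<^sub>v ?z) = v \<bullet> w - x * (v \<bullet> (A *\<^sub>v w)) - (x * (w \<bullet> w) - x * (x * (w \<bullet> (A *\<^sub>v w))))"
        unfolding Az using v w Aw xw
        by (simp add: minus_scalar_prod_distrib[of _ n] scalar_prod_minus_distrib[of _ n])
      also have "v \<bullet> (A *\<^sub>v w) = w \<bullet> w"
        using sym[OF v w] by (simp add: w_def)
      finally have "?z \<bullet> (A *\<^sub>v ?z) = v \<bullet> w - 2 * (x * (w \<bullet> w)) + x\<^sup>2 * (w \<bullet> (A *\<^sub>v w))"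
        by (simp add: power2_eq_square)
      moreover have "?z \<in> carrier_vec n" using v xw by auto
      ultimately show ?thesis using psd by metis
    qed
    from quadratic_nonneg_discriminant[OF this psd[OF w]]
    have "(w \<bullet> w)\<^sup>2 \<le> (v \<bullet> w) * (w \<bullet> (A *\<^sub>v w))" .
    also have "\<dots> \<le> (v \<bullet> w) * (L * (w \<bullet> w))"
      using quad[OF w] psd[OF v] scalar_prod_self_nonneg[of w]
      by (intro mult_left_mono) (auto simp: w_def L_def distrib_right)
    finally have *: "(w \<bullet> w) * (w \<bullet> w) \<le> (L * (v \<bullet> w)) * (w \<bullet> w)"
      by (simp add: power2_eq_square mult_ac)
    show ?thesis
    proof (cases "w \<bullet> w = 0")
      case True
      then show ?thesis using psd[OF v] \<open>L > 0\<close> by (simp add: w_def)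
    next
      case False
      then have "w \<bullet> w > 0" using scalar_prod_self_nonneg[of w] by simp
      with * show ?thesis by (simp add: w_def)
    qed
  qed
  with \<open>L > 0\<close> show ?thesis by blast
qed

lemma exists_unit_vec:
  assumes "n > 0"
  obtains v :: "real Matrix.vec" where "v \<in> carrier_vec n" "v \<bullet> v = 1"
  using assms that[of "unit_vec n 0"] by simp

text \<open>The supremum \<open>R\<close> of the Rayleigh quotient is an eigenvalue: otherwise \<open>R - B\<close> is positive
  semidefinite and invertible, hence bounded below, and \<open>R\<close> could be decreased. This avoids the
  spectral theorem and compactness of the sphere.\<close>

lemma quadratic_form_le_lambda_max:
  fixes B :: "real Matrix.mat"
  assumes B: "B \<in> carrier_mat n n" and n: "n > 0"
    and sym: "\<And>v w. v \<in> carrier_vec n \<Longrightarrow> w \<in> carrier_vec n \<Longrightarrow> v \<bullet> (B *\<^sub>v w) = w \<bullet> (B *\<^sub>v v)"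
    and v: "v \<in> carrier_vec n"
  shows "v \<bullet> (B *\<^sub>v v) \<le> lambda_max B * (v \<bullet> v)"
proof -
  define U where "U = (\<lambda>v. v \<bullet> (B *\<^sub>v v)) ` {v \<in> carrier_vec n. v \<bullet> v = (1::real)}"
  define R where "R = Sup U"
  have U_ne: "U \<noteq> {}"
    by (rule exists_unit_vec[OF n]) (auto simp: U_def)
  obtain K where K: "K > 0" "\<And>v. v \<in> carrier_vec n \<Longrightarrow> (B *\<^sub>v v) \<bullet> (B *\<^sub>v v) \<le> K * (v \<bullet> v)"
    using mult_mat_vec_bounded[OF B] by blast
  have "x \<le> sqrt K" if x: "x \<in> U" for x
  proof -
    obtain v where v: "v \<in> carrier_vec n" "v \<bullet> v = 1" "x = v \<bullet> (B *\<^sub>v v)"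
      using x by (auto simp: U_def)
    have "x\<^sup>2 \<le> (v \<bullet> v) * ((B *\<^sub>v v) \<bullet> (B *\<^sub>v v))"
      unfolding v(3) by (rule scalar_prod_Cauchy_Schwarz[OF v(1)]) (use B v in auto)
    then show ?thesis using K(2)[OF v(1)] v(2) by (intro real_le_rsqrt) simp
  qed
  then have bdd: "bdd_above U" by (auto simp: bdd_above_def)
  have le_R: "v \<bullet> (B *\<^sub>v v) \<le> R * (v \<bullet> v)" if v: "v \<in> carrier_vec n" for v
  proof (cases "v \<bullet> v = 0")
    case True
    have "v $ i = 0" if "i < n" for i
      using True v that by (simp add: scalar_prod_def sum_nonneg_eq_0_iff)
    then have "v = 0\<^sub>v n" using v by auto
    then show ?thesis using B by simp
  next
    case False
    then have pos: "v \<bullet> v > 0" using scalar_prod_self_nonneg[of v] by simp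
    define s where "s = 1 / sqrt (v \<bullet> v)"
    have s2: "s * s = 1 / (v \<bullet> v)" using pos by (simp add: s_def)
    have "s \<cdot>\<^sub>v v \<in> carrier_vec n" "(s \<cdot>\<^sub>v v) \<bullet> (s \<cdot>\<^sub>v v) = 1"
      using v s2 pos by (auto simp: mult.assoc[symmetric])
    then have "(s \<cdot>\<^sub>v v) \<bullet> (B *\<^sub>v (s \<cdot>\<^sub>v v)) \<in> U"
      unfolding U_def by blast
    then have "(s \<cdot>\<^sub>v v) \<bullet> (B *\<^sub>v (s \<cdot>\<^sub>v v)) \<le> R"
      unfolding R_def by (rule cSup_upper[OF _ bdd])
    moreover have "(s \<cdot>\<^sub>v v) \<bullet> (B *\<^sub>v (s \<cdot>\<^sub>v v)) = (s * s) * (v \<bullet> (B *\<^sub>v v))"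
      using v B by (simp add: mult_mat_vec[OF B v])
    ultimately show ?thesis using pos by (simp add: s2 field_simps)
  qed
  define A where "A = R \<cdot>\<^sub>m 1\<^sub>m n - B"
  have A: "A \<in> carrier_mat n n" unfolding A_def by (rule minus_carrier_mat[OF B])
  have A_vec: "A *\<^sub>v v = R \<cdot>\<^sub>v v - B *\<^sub>v v" if "v \<in> carrier_vec n" for v
  proof -
    have "(R \<cdot>\<^sub>m 1\<^sub>m n) *\<^sub>v v = R \<cdot>\<^sub>v v"
      using that by (intro eq_vecI) (auto simp: row_smult)
    then show ?thesis
      unfolding A_def using minus_mult_distrib_mat_vec[of "R \<cdot>\<^sub>m 1\<^sub>m n" n n B v] B that by simp
  qed
  have A_form: "w \<bullet> (A *\<^sub>v v) = R * (w \<bullet> v) - w \<bullet> (B *\<^sub>v v)"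
    if "v \<in> carrier_vec n" "w \<in> carrier_vec n" for v w
    unfolding A_vec[OF that(1)] using that B by (simp add: scalar_prod_minus_distrib[of _ n])
  have "Determinant.det A = 0"
  proof (rule ccontr)
    assume "Determinant.det A \<noteq> 0"
    then have "A \<in> Units (ring_mat TYPE(real) n ())"
      by (rule det_non_zero_imp_unit[OF A])
    then obtain A' where A': "A' \<in> carrier_mat n n" "A' * A = 1\<^sub>m n"
      by (auto simp: Units_def ring_mat_simps)
    obtain L where L: "L > 0" "\<And>v. v \<in> carrier_vec n \<Longrightarrow> (A *\<^sub>v v) \<bullet> (A *\<^sub>v v) \<le> L * (v \<bullet> (A *\<^sub>v v))"
    proof -
      have "v \<bullet> (A *\<^sub>v w) = w \<bullet> (A *\<^sub>v v)" if "v \<in> carrier_vec n" "w \<in> carrier_vec n" for v w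
        using that sym[OF that] by (simp add: A_form comm_scalar_prod[of v n w])
      moreover have "0 \<le> v \<bullet> (A *\<^sub>v v)" if "v \<in> carrier_vec n" for v
        using that le_R by (simp add: A_form)
      ultimately show thesis
        using psd_mult_mat_vec_bounded[OF A] that by blast
    qed
    obtain K where K: "K > 0" "\<And>v. v \<in> carrier_vec n \<Longrightarrow> (A' *\<^sub>v v) \<bullet> (A' *\<^sub>v v) \<le> K * (v \<bullet> v)"
      using mult_mat_vec_bounded[OF A'(1)] by blast
    have "x \<le> R - 1 / (K * L)" if x: "x \<in> U" for x
    proof -
      obtain v where v: "v \<in> carrier_vec n" "v \<bullet> v = 1" "x = v \<bullet> (B *\<^sub>v v)"
        using x by (auto simp: U_def)
      have Av: "A *\<^sub>v v \<in> carrier_vec n" using A v by auto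
      have "A' *\<^sub>v (A *\<^sub>v v) = v"
        using assoc_mult_mat_vec[OF A'(1) A v(1)] A'(2) v(1) by simp
      then have "1 \<le> K * ((A *\<^sub>v v) \<bullet> (A *\<^sub>v v))"
        using K(2)[OF Av] v(2) by simp
      also have "\<dots> \<le> K * (L * (v \<bullet> (A *\<^sub>v v)))"
        using L(2)[OF v(1)] K(1) by (intro mult_left_mono) auto
      also have "v \<bullet> (A *\<^sub>v v) = R - x"
        using A_form[OF v(1) v(1)] v by simp
      finally show ?thesis using K(1) L(1) by (simp add: field_simps)
    qed
    then have "R \<le> R - 1 / (K * L)"
      unfolding R_def by (intro cSup_least[OF U_ne]) auto
    moreover have "1 / (K * L) > 0" using K(1) L(1) by simp
    ultimately show False by simp
  qed
  then obtain u where u: "u \<in> carrier_vec n" "u \<noteq> 0\<^sub>v n" "A *\<^sub>v u = 0\<^sub>v n"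
    using det_0_iff_vec_prod_zero_field[OF A] by blast
  have "B *\<^sub>v u = R \<cdot>\<^sub>v u"
  proof (rule eq_vecI)
    fix i assume "i < dim_vec (R \<cdot>\<^sub>v u)"
    then have i: "i < n" using u by simp
    have "(R \<cdot>\<^sub>v u - B *\<^sub>v u) $ i = 0\<^sub>v n $ i"
      using A_vec[OF u(1)] u(3) by simp
    then show "(B *\<^sub>v u) $ i = (R \<cdot>\<^sub>v u) $ i"
      using i u(1) B by simp
  qed (use B u in auto)
  then have "R \<in> spectrum B"
    using u B unfolding spectrum_def eigenvalue_def eigenvector_def by auto
  then have "R \<le> lambda_max B"
    unfolding lambda_max_def using card_finite_spectrum(1)[OF B] by (intro Max_ge)
  then have "R * (v \<bullet> v) \<le> lambda_max B * (v \<bullet> v)"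
    by (intro mult_right_mono scalar_prod_self_nonneg)
  with le_R[OF v] show ?thesis by simp
qed

section \<open>Gaussian random variables\<close>

lemma (in prob_space) gaussian_rv_cases:
  assumes "gaussian_rv M X"
  obtains \<mu> where "AE w in M. X w = \<mu>"
  | \<mu> \<sigma> where "0 < \<sigma>" "distributed M lborel X (normal_density \<mu> \<sigma>)"
proof -
  from assms obtain \<mu> \<sigma> where [measurable]: "X \<in> borel_measurable M" and "0 \<le> \<sigma>"
    and D: "distr M borel X = (if \<sigma> = 0 then return borel \<mu> else density lborel (normal_density \<mu> \<sigma>))"
    unfolding gaussian_rv_def by blast
  show thesis
  proof (cases "\<sigma> = 0")
    case True
    have "AE x in return borel \<mu>. x = \<mu>"
      by (subst AE_return) auto
    moreover have "distr M borel X = return borel \<mu>"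
      using D True by simp
    ultimately have "AE x in distr M borel X. x = \<mu>"
      by metis
    then have "AE w in M. X w = \<mu>"
      by (subst (asm) AE_distr_iff) auto
    then show thesis by (rule that(1))
  next
    case False
    have "distr M lborel X = distr M borel X"
      by (rule distr_cong) auto
    then have "distributed M lborel X (normal_density \<mu> \<sigma>)"
      using D False by (simp add: distributed_def)
    then show thesis using False \<open>0 \<le> \<sigma>\<close> by (intro that(2)) auto
  qed
qed

lemma (in prob_space) gaussian_rv_measurable: "gaussian_rv M X \<Longrightarrow> X \<in> borel_measurable M"
  by (simp add: gaussian_rv_def)

lemma (in prob_space) gaussian_rv_square_integrable:
  assumes G: "gaussian_rv M X"
  shows "integrable M (\<lambda>w. (X w)\<^sup>2)"
proof (cases rule: gaussian_rv_cases[OF G])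
  case (1 \<mu>)
  note [measurable] = gaussian_rv_measurable[OF G]
  have "integrable M (\<lambda>w. (X w)\<^sup>2) \<longleftrightarrow> integrable M (\<lambda>w. \<mu>\<^sup>2)"
    by (rule integrable_cong_AE) (use 1 in auto)
  then show ?thesis by simp
next
  case (2 \<mu> \<sigma>)
  have "integrable lborel (\<lambda>x. normal_density \<mu> \<sigma> x * (x - \<mu>)\<^sup>2 + 2 * \<mu> * (normal_density \<mu> \<sigma> x * x) - \<mu>\<^sup>2 * normal_density \<mu> \<sigma> x)"
    by (intro Bochner_Integration.integrable_add Bochner_Integration.integrable_diff integrable_mult_right integrable_normal_moment
        integrable_normal_moment_nz_1 integrable_normal_density 2)
  then have "integrable lborel (\<lambda>x. normal_density \<mu> \<sigma> x * x\<^sup>2)"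
    by (simp add: power2_diff algebra_simps power2_eq_square)
  then show ?thesis
    by (subst distributed_integrable[OF 2(2), symmetric]) auto
qed

lemma (in prob_space) gaussian_rv_integrable:
  assumes "gaussian_rv M X"
  shows "integrable M X"
  by (rule square_integrable_imp_integrable[OF gaussian_rv_measurable gaussian_rv_square_integrable])
    (rule assms)+

lemma (in prob_space) gaussian_rv_exp_moment:
  assumes G: "gaussian_rv M X" and mean: "expectation X = 0"
  shows "(\<integral>\<^sup>+w. ennreal (exp (X w)) \<partial>M) = ennreal (exp (expectation (\<lambda>w. (X w)\<^sup>2) / 2))"
proof (cases rule: gaussian_rv_cases[OF G])
  case (1 \<mu>)
  note [measurable] = gaussian_rv_measurable[OF G]
  have "expectation X = expectation (\<lambda>w. \<mu>)"
    by (rule integral_cong_AE) (use 1 in auto)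
  then have "\<mu> = 0" using mean by (simp add: prob_space)
  have "(\<integral>\<^sup>+w. ennreal (exp (X w)) \<partial>M) = (\<integral>\<^sup>+w. 1 \<partial>M)"
    by (rule nn_integral_cong_AE) (use 1 \<open>\<mu> = 0\<close> in auto)
  moreover have "expectation (\<lambda>w. (X w)\<^sup>2) = expectation (\<lambda>w. 0)"
    by (rule integral_cong_AE) (use 1 \<open>\<mu> = 0\<close> in auto)
  ultimately show ?thesis by (simp add: emeasure_space_1)
next
  case (2 \<mu> \<sigma>)
  have "\<mu> = 0" using normal_distributed_expectation[OF 2(1) 2(2)] mean by simp
  have var: "expectation (\<lambda>w. (X w)\<^sup>2) = \<sigma>\<^sup>2"
    using normal_distributed_variance[OF 2(1) 2(2)] mean by simp
  have "(\<integral>\<^sup>+w. ennreal (exp (X w)) \<partial>M) = (\<integral>\<^sup>+x. ennreal (normal_density \<mu> \<sigma> x) * ennreal (exp x) \<partial>lborel)"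
    by (rule distributed_nn_integral[OF 2(2), symmetric]) auto
  also have "\<dots> = (\<integral>\<^sup>+x. ennreal (exp (\<sigma>\<^sup>2 / 2)) * ennreal (normal_density (\<sigma>\<^sup>2) \<sigma> x) \<partial>lborel)"
  proof (intro nn_integral_cong)
    fix x
    have "- x\<^sup>2 / (2 * \<sigma>\<^sup>2) + x = \<sigma>\<^sup>2 / 2 + - (x - \<sigma>\<^sup>2)\<^sup>2 / (2 * \<sigma>\<^sup>2)"
      using 2(1) by (simp add: field_simps power2_eq_square)
    then have "exp (- x\<^sup>2 / (2 * \<sigma>\<^sup>2)) * exp x = exp (\<sigma>\<^sup>2 / 2) * exp (- (x - \<sigma>\<^sup>2)\<^sup>2 / (2 * \<sigma>\<^sup>2))"
      by (simp only: exp_add[symmetric])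
    then have "normal_density 0 \<sigma> x * exp x = exp (\<sigma>\<^sup>2 / 2) * normal_density (\<sigma>\<^sup>2) \<sigma> x"
      unfolding normal_density_def by (simp add: mult_ac)
    then show "ennreal (normal_density \<mu> \<sigma> x) * ennreal (exp x) = ennreal (exp (\<sigma>\<^sup>2 / 2)) * ennreal (normal_density (\<sigma>\<^sup>2) \<sigma> x)"
      by (simp add: \<open>\<mu> = 0\<close> ennreal_mult[symmetric])
  qed
  also have "\<dots> = ennreal (exp (\<sigma>\<^sup>2 / 2)) * (\<integral>\<^sup>+x. ennreal (normal_density (\<sigma>\<^sup>2) \<sigma> x) \<partial>lborel)"
    by (rule nn_integral_cmult) auto
  also have "(\<integral>\<^sup>+x. ennreal (normal_density (\<sigma>\<^sup>2) \<sigma> x) \<partial>lborel) = 1"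
    using nn_integral_eq_integral[OF integrable_normal_density[OF 2(1), of "\<sigma>\<^sup>2"]]
      integral_normal_density[OF 2(1), of "\<sigma>\<^sup>2"] by simp
  finally show ?thesis by (simp add: var)
qed

lemma (in prob_space) gaussian_rv_sin_moment:
  assumes G: "gaussian_rv M X"
  obtains \<sigma> where "\<And>t. expectation (\<lambda>w. sin (t * X w)) = sin (t * expectation X) * exp (- (t * \<sigma>)\<^sup>2 / 2)"
proof (cases rule: gaussian_rv_cases[OF G])
  case (1 \<mu>)
  note [measurable] = gaussian_rv_measurable[OF G]
  have "expectation X = expectation (\<lambda>w. \<mu>)"
    by (rule integral_cong_AE) (use 1 in auto)
  moreover have "expectation (\<lambda>w. sin (t * X w)) = expectation (\<lambda>w. sin (t * \<mu>))" for t
    by (rule integral_cong_AE) (use 1 in auto)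
  ultimately show thesis by (intro that[of 0]) (simp add: prob_space)
next
  case (2 \<mu> \<sigma>)
  define Z where "Z w = (X w - \<mu>) / \<sigma>" for w
  have Z: "distributed M lborel Z std_normal_density"
    using 2 normal_standard_normal_convert[OF 2(1), of X \<mu>] by (simp add: Z_def[abs_def])
  then have [measurable]: "Z \<in> borel_measurable M" by (simp add: distributed_def)
  have law: "distr M borel Z = std_normal_distribution"
  proof -
    have "distr M borel Z = distr M lborel Z" by (rule distr_cong) auto
    then show ?thesis using Z by (simp add: distributed_def)
  qed
  have char: "(CLINT w|M. iexp (s * Z w)) = complex_of_real (exp (- s\<^sup>2 / 2))" for s
  proof -
    have "char std_normal_distribution s = (CLINT w|M. iexp (s * Z w))"
      unfolding char_def law[symmetric] by (subst integral_distr) auto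
    then show ?thesis by (simp add: char_std_normal_distribution)
  qed
  have int: "integrable M (\<lambda>w. iexp (s * Z w))" for s
    by (rule integrable_const_bound[of _ 1]) auto
  have sin0: "expectation (\<lambda>w. sin (s * Z w)) = 0" for s
    using integral_Im[OF int[of s]] char[of s] by (simp add: Im_exp)
  have cos0: "expectation (\<lambda>w. cos (s * Z w)) = exp (- s\<^sup>2 / 2)" for s
    using integral_Re[OF int[of s]] char[of s] by (simp add: Re_exp)
  have mean: "expectation X = \<mu>" by (rule normal_distributed_expectation[OF 2])
  show thesis
  proof (rule that[of \<sigma>])
    fix t
    have "sin (t * X w) = sin (t * \<mu>) * cos ((t * \<sigma>) * Z w) + cos (t * \<mu>) * sin ((t * \<sigma>) * Z w)" for w
    proof -
      have "X w = \<mu> + \<sigma> * Z w" using 2(1) by (simp add: Z_def)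
      then have "t * X w = t * \<mu> + (t * \<sigma>) * Z w" by (simp add: algebra_simps)
      then show ?thesis by (simp only: sin_add)
    qed
    moreover have "integrable M (\<lambda>w. cos ((t * \<sigma>) * Z w))" "integrable M (\<lambda>w. sin ((t * \<sigma>) * Z w))"
      by (rule integrable_const_bound[of _ 1]; auto)+
    ultimately show "expectation (\<lambda>w. sin (t * X w)) = sin (t * expectation X) * exp (- (t * \<sigma>)\<^sup>2 / 2)"
      by (simp add: sin0 cos0 mean)
  qed
qed

text \<open>Convergence in probability passes to \<open>E sin (t X)\<close>, which vanishes for all \<open>t\<close> if and only
  if the Gaussian variable \<open>X\<close> is centred.\<close>

lemma (in prob_space) gaussian_limit_centred:
  assumes J: "gaussian_rv M J"
    and lim: "\<And>\<epsilon>. \<epsilon> > 0 \<Longrightarrow> \<exists>X. gaussian_rv M X \<and> expectation X = 0 \<and>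
        measure M {w \<in> space M. \<bar>X w - J w\<bar> > \<epsilon>} < \<epsilon>"
  shows "expectation J = 0"
proof (rule ccontr)
  assume ne: "expectation J \<noteq> 0"
  note [measurable] = gaussian_rv_measurable[OF J]
  have zero: "expectation (\<lambda>w. sin (t * J w)) = 0" for t
  proof -
    have "\<bar>expectation (\<lambda>w. sin (t * J w))\<bar> \<le> (\<bar>t\<bar> + 2) * \<epsilon>" if \<epsilon>: "\<epsilon> > 0" for \<epsilon>
    proof -
      obtain X where X: "gaussian_rv M X" "expectation X = 0" "measure M {w \<in> space M. \<bar>X w - J w\<bar> > \<epsilon>} < \<epsilon>"
        using lim[OF \<epsilon>] by blast
      note [measurable] = gaussian_rv_measurable[OF X(1)]
      let ?A = "{w \<in> space M. \<bar>X w - J w\<bar> > \<epsilon>}"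
      have X0: "expectation (\<lambda>w. sin (t * X w)) = 0"
        by (rule gaussian_rv_sin_moment[OF X(1)]) (simp add: X(2))
      have int: "integrable M (\<lambda>w. sin (t * J w))" "integrable M (\<lambda>w. sin (t * X w))"
        by (rule integrable_const_bound[of _ 1]; auto)+
      have "\<bar>sin (t * J w) - sin (t * X w)\<bar> \<le> \<bar>t\<bar> * \<epsilon> + 2 * indicator ?A w" if "w \<in> space M" for w
      proof (cases "w \<in> ?A")
        case True
        have "\<bar>sin (t * J w) - sin (t * X w)\<bar> \<le> 2"
          using abs_sin_le_one[of "t * J w"] abs_sin_le_one[of "t * X w"] by linarith
        moreover have "0 \<le> \<bar>t\<bar> * \<epsilon>" using \<open>\<epsilon> > 0\<close> by simp
        ultimately show ?thesis using True by simp
      next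
        case False
        have "\<bar>sin (t * J w) - sin (t * X w)\<bar> \<le> \<bar>t * J w - t * X w\<bar>"
          using abs_sin_x_le_abs_x[of "(t * J w - t * X w) / 2"] abs_cos_le_one[of "(t * J w + t * X w) / 2"]
            mult_mono[of "\<bar>sin ((t * J w - t * X w) / 2)\<bar>" "\<bar>(t * J w - t * X w) / 2\<bar>"
              "\<bar>cos ((t * J w + t * X w) / 2)\<bar>" 1]
          by (simp add: sin_diff_sin abs_mult)
        also have "\<dots> = \<bar>t\<bar> * \<bar>J w - X w\<bar>"
          by (simp add: abs_mult[symmetric] right_diff_distrib)
        also have "\<dots> \<le> \<bar>t\<bar> * \<epsilon>"
          using False that by (intro mult_left_mono) auto
        finally show ?thesis using False by simp
      qed
      then have "expectation (\<lambda>w. \<bar>sin (t * J w) - sin (t * X w)\<bar>) \<le> expectation (\<lambda>w. \<bar>t\<bar> * \<epsilon> + 2 * indicator ?A w)"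
        using int by (intro integral_mono) (auto intro!: integrable_real_mult_indicator)
      also have "\<dots> = \<bar>t\<bar> * \<epsilon> + 2 * measure M ?A"
      proof -
        have "integrable M (indicat_real ?A)"
          by (rule integrable_const_bound[of _ 1]) auto
        then show ?thesis by (subst Bochner_Integration.integral_add) (auto simp: prob_space)
      qed
      also have "\<dots> \<le> (\<bar>t\<bar> + 2) * \<epsilon>"
        using X(3) by (simp add: distrib_right)
      finally have "expectation (\<lambda>w. \<bar>sin (t * J w) - sin (t * X w)\<bar>) \<le> (\<bar>t\<bar> + 2) * \<epsilon>" .
      moreover have "\<bar>expectation (\<lambda>w. sin (t * J w) - sin (t * X w))\<bar> \<le> expectation (\<lambda>w. \<bar>sin (t * J w) - sin (t * X w)\<bar>)"
        by (rule integral_abs_bound)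
      ultimately show ?thesis
        using int by (simp add: X0)
    qed
    note bound = this
    have "\<bar>expectation (\<lambda>w. sin (t * J w))\<bar> \<le> 0"
    proof (rule field_le_epsilon)
      fix e :: real assume "0 < e"
      then have "\<bar>expectation (\<lambda>w. sin (t * J w))\<bar> \<le> (\<bar>t\<bar> + 2) * (e / (\<bar>t\<bar> + 2))"
        by (intro bound) (simp add: add_nonneg_pos)
      also have "\<dots> = e" by (simp add: add_nonneg_pos)
      finally show "\<bar>expectation (\<lambda>w. sin (t * J w))\<bar> \<le> 0 + e" by simp
    qed
    then show ?thesis by simp
  qed
  have "sin (t * expectation J) = 0" for t
    by (rule gaussian_rv_sin_moment[OF J]) (metis zero mult_eq_0_iff exp_not_eq_zero)
  from this[of "pi / 2 / expectation J"] ne show False by simp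
qed

lemma nn_integral_exp_std_normal:
  "(\<integral>\<^sup>+x. ennreal (exp (a * x)) \<partial>std_normal_distribution) = ennreal (exp (a\<^sup>2 / 2))"
proof -
  have "(\<integral>\<^sup>+x. ennreal (exp (a * x)) \<partial>std_normal_distribution)
      = (\<integral>\<^sup>+x. ennreal (std_normal_density x) * ennreal (exp (a * x)) \<partial>lborel)"
    by (rule nn_integral_density) auto
  also have "\<dots> = (\<integral>\<^sup>+x. ennreal (exp (a\<^sup>2 / 2)) * ennreal (normal_density a 1 x) \<partial>lborel)"
  proof (intro nn_integral_cong)
    fix x
    have "- x\<^sup>2 / 2 + a * x = a\<^sup>2 / 2 + - (x - a)\<^sup>2 / 2"
      by (simp add: field_simps power2_eq_square)
    then have "exp (- x\<^sup>2 / 2) * exp (a * x) = exp (a\<^sup>2 / 2) * exp (- (x - a)\<^sup>2 / 2)"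
      by (simp only: exp_add[symmetric])
    then have "std_normal_density x * exp (a * x) = exp (a\<^sup>2 / 2) * normal_density a 1 x"
      unfolding normal_density_def by (simp add: mult_ac)
    then show "ennreal (std_normal_density x) * ennreal (exp (a * x)) = ennreal (exp (a\<^sup>2 / 2)) * ennreal (normal_density a 1 x)"
      by (simp add: ennreal_mult[symmetric])
  qed
  also have "\<dots> = ennreal (exp (a\<^sup>2 / 2)) * (\<integral>\<^sup>+x. ennreal (normal_density a 1 x) \<partial>lborel)"
    by (rule nn_integral_cmult) auto
  also have "(\<integral>\<^sup>+x. ennreal (normal_density a 1 x) \<partial>lborel) = 1"
    using nn_integral_eq_integral[OF integrable_normal_density[of 1 a]] integral_normal_density[of 1 a] by simp
  finally show ?thesis by simp
qed

lemma nn_integral_exp_square_std_normal: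
  "(\<integral>\<^sup>+x. ennreal (exp (x\<^sup>2 / 4)) \<partial>std_normal_distribution) = ennreal (sqrt 2)"
proof -
  have "(\<integral>\<^sup>+x. ennreal (exp (x\<^sup>2 / 4)) \<partial>std_normal_distribution)
      = (\<integral>\<^sup>+x. ennreal (std_normal_density x) * ennreal (exp (x\<^sup>2 / 4)) \<partial>lborel)"
    by (rule nn_integral_density) auto
  also have "\<dots> = (\<integral>\<^sup>+x. ennreal (sqrt 2) * ennreal (normal_density 0 (sqrt 2) x) \<partial>lborel)"
  proof (intro nn_integral_cong)
    fix x :: real
    have "exp (- x\<^sup>2 / 2) * exp (x\<^sup>2 / 4) = exp (- x\<^sup>2 / 4)"
      by (simp add: exp_add[symmetric] field_simps)
    then have "std_normal_density x * exp (x\<^sup>2 / 4) = sqrt 2 * normal_density 0 (sqrt 2) x"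
      unfolding normal_density_def by (simp add: real_sqrt_mult field_simps)
    then show "ennreal (std_normal_density x) * ennreal (exp (x\<^sup>2 / 4)) = ennreal (sqrt 2) * ennreal (normal_density 0 (sqrt 2) x)"
      by (simp add: ennreal_mult[symmetric])
  qed
  also have "\<dots> = ennreal (sqrt 2) * (\<integral>\<^sup>+x. ennreal (normal_density 0 (sqrt 2) x) \<partial>lborel)"
    by (rule nn_integral_cmult) auto
  also have "(\<integral>\<^sup>+x. ennreal (normal_density 0 (sqrt 2) x) \<partial>lborel) = 1"
    using nn_integral_eq_integral[OF integrable_normal_density[of "sqrt 2" 0]] integral_normal_density[of "sqrt 2" 0] by simp
  finally show ?thesis by simp
qed

text \<open>Gaussian linearization: \<open>exp (x\<^sup>2 / (4 \<kappa>))\<close> is the expectation of \<open>exp (g x / sqrt (2 \<kappa>))\<close> over a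
  standard normal \<open>g\<close>, so after Tonelli only exponential moments of linear forms are needed.\<close>

lemma (in prob_space) exp_square_sum_moment:
  fixes X :: "'i \<Rightarrow> 'a \<Rightarrow> real"
  assumes I: "finite I" and \<kappa>: "\<kappa> > 0"
    and X[measurable]: "\<And>i. i \<in> I \<Longrightarrow> X i \<in> borel_measurable M"
    and mgf: "\<And>g. (\<integral>\<^sup>+w. ennreal (exp (\<Sum>i\<in>I. g i * X i w)) \<partial>M) \<le> ennreal (exp (\<kappa> / 2 * (\<Sum>i\<in>I. (g i)\<^sup>2)))"
  shows "(\<integral>\<^sup>+w. ennreal (exp ((\<Sum>i\<in>I. (X i w)\<^sup>2) / (4 * \<kappa>))) \<partial>M) \<le> ennreal (sqrt 2 ^ card I)"
proof -
  let ?N = "std_normal_distribution"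
  let ?G = "Pi\<^sub>M I (\<lambda>_. ?N)"
  let ?c = "1 / sqrt (2 * \<kappa>)"
  have N: "prob_space ?N" by (rule prob_space_normal_density) simp
  interpret N: prob_space ?N by (rule N)
  interpret P: product_sigma_finite "\<lambda>_::'i. ?N" by unfold_locales
  interpret G: prob_space ?G by (rule prob_space_PiM) (rule N)
  interpret pair_sigma_finite ?G M by unfold_locales
  have c2: "(?c * x)\<^sup>2 / 2 = x\<^sup>2 / (4 * \<kappa>)" for x
    using \<kappa> by (simp add: power_mult_distrib power_divide)
  have lin: "ennreal (exp ((\<Sum>i\<in>I. (X i w)\<^sup>2) / (4 * \<kappa>)))
      = (\<integral>\<^sup>+g. ennreal (exp (\<Sum>i\<in>I. (?c * g i) * X i w)) \<partial>?G)" for w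
  proof -
    have "(\<integral>\<^sup>+g. ennreal (exp (\<Sum>i\<in>I. (?c * g i) * X i w)) \<partial>?G)
        = (\<integral>\<^sup>+g. (\<Prod>i\<in>I. ennreal (exp ((?c * X i w) * g i))) \<partial>?G)"
      using I by (intro nn_integral_cong) (simp add: exp_sum prod_ennreal mult_ac)
    also have "\<dots> = (\<Prod>i\<in>I. \<integral>\<^sup>+x. ennreal (exp ((?c * X i w) * x)) \<partial>?N)"
      by (rule P.product_nn_integral_prod[OF I]) auto
    also have "\<dots> = (\<Prod>i\<in>I. ennreal (exp ((X i w)\<^sup>2 / (4 * \<kappa>))))"
      by (simp only: nn_integral_exp_std_normal c2)
    also have "\<dots> = ennreal (exp ((\<Sum>i\<in>I. (X i w)\<^sup>2) / (4 * \<kappa>)))"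
      using I by (simp add: prod_ennreal exp_sum sum_divide_distrib)
    finally show ?thesis by simp
  qed
  have "(\<integral>\<^sup>+w. ennreal (exp ((\<Sum>i\<in>I. (X i w)\<^sup>2) / (4 * \<kappa>))) \<partial>M)
      = (\<integral>\<^sup>+w. (\<integral>\<^sup>+g. ennreal (exp (\<Sum>i\<in>I. (?c * g i) * X i w)) \<partial>?G) \<partial>M)"
    by (simp only: lin)
  also have "\<dots> = (\<integral>\<^sup>+g. (\<integral>\<^sup>+w. ennreal (exp (\<Sum>i\<in>I. (?c * g i) * X i w)) \<partial>M) \<partial>?G)"
    by (rule Fubini') measurable
  also have "\<dots> \<le> (\<integral>\<^sup>+g. (\<Prod>i\<in>I. ennreal (exp ((g i)\<^sup>2 / 4))) \<partial>?G)"
  proof (intro nn_integral_mono)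
    fix g :: "'i \<Rightarrow> real"
    have "\<kappa> / 2 * (\<Sum>i\<in>I. (?c * g i)\<^sup>2) = (\<Sum>i\<in>I. (g i)\<^sup>2 / 4)"
      unfolding sum_distrib_left
    proof (intro sum.cong refl)
      fix i show "\<kappa> / 2 * (?c * g i)\<^sup>2 = (g i)\<^sup>2 / 4"
        using c2[of "g i"] \<kappa> by (simp add: field_simps)
    qed
    then have "(\<integral>\<^sup>+w. ennreal (exp (\<Sum>i\<in>I. (?c * g i) * X i w)) \<partial>M) \<le> ennreal (exp (\<Sum>i\<in>I. (g i)\<^sup>2 / 4))"
      using mgf[of "\<lambda>i. ?c * g i"] by simp
    also have "\<dots> = (\<Prod>i\<in>I. ennreal (exp ((g i)\<^sup>2 / 4)))"
      using I by (simp add: prod_ennreal exp_sum)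
    finally show "(\<integral>\<^sup>+w. ennreal (exp (\<Sum>i\<in>I. (?c * g i) * X i w)) \<partial>M) \<le> (\<Prod>i\<in>I. ennreal (exp ((g i)\<^sup>2 / 4)))" .
  qed
  also have "\<dots> = (\<Prod>i\<in>I. \<integral>\<^sup>+x. ennreal (exp (x\<^sup>2 / 4)) \<partial>?N)"
    by (rule P.product_nn_integral_prod[OF I]) auto
  also have "\<dots> = ennreal (sqrt 2 ^ card I)"
    by (simp add: nn_integral_exp_square_std_normal ennreal_power)
  finally show ?thesis .
qed

section \<open>The noise coefficients\<close>

lemma step_integral_eq_sum_times:
  fixes t :: "nat \<Rightarrow> real"
  shows "step_integral k t c w = (\<Sum>s\<in>t ` {..k}.
    (\<Sum>i<k. c i * ((if t (Suc i) = s then 1 else 0) - (if t i = s then 1 else 0))) * w s)"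
proof -
  have eval: "(\<Sum>s\<in>t ` {..k}. (if t i = s then 1 else 0) * w s) = w (t i)" if "i \<le> k" for i
  proof -
    have "(\<Sum>s\<in>t ` {..k}. (if t i = s then 1 else 0) * w s) = (\<Sum>s\<in>t ` {..k}. if s = t i then w s else 0)"
      by (intro sum.cong) auto
    also have "\<dots> = w (t i)" using that by simp
    finally show ?thesis .
  qed
  have "(\<Sum>s\<in>t ` {..k}. (\<Sum>i<k. c i * ((if t (Suc i) = s then 1 else 0) - (if t i = s then 1 else 0))) * w s)
      = (\<Sum>i<k. \<Sum>s\<in>t ` {..k}. c i * ((if t (Suc i) = s then 1 else 0) * w s - (if t i = s then 1 else 0) * w s))"
    unfolding sum_distrib_right by (subst sum.swap) (simp only: mult.assoc left_diff_distrib)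
  also have "\<dots> = (\<Sum>i<k. c i * (w (t (Suc i)) - w (t i)))"
    by (intro sum.cong refl) (simp only: sum_distrib_left[symmetric] sum_subtractf eval Suc_leI lessThan_iff less_imp_le)
  finally show ?thesis by (simp add: step_integral_def)
qed

lemma step_integral_gaussian:
  assumes Q: "centred_gaussian_process Q" and part: "partition_of T k t"
  shows "gaussian_rv Q (step_integral k t c)" "(\<integral>w. step_integral k t c w \<partial>Q) = 0"
proof -
  interpret prob_space Q using Q by (simp add: centred_gaussian_process_def path_law_def)
  have fam: "gaussian_rv Q (\<lambda>w. \<Sum>s\<in>F. d s * w s)" if "finite F" "F \<subseteq> {0..}" for F d
    using Q that by (simp add: centred_gaussian_process_def gaussian_family_def)
  have times: "t ` {..k} \<subseteq> {0..}" using partition_of_mem(1)[OF part] by auto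
  have eq: "step_integral k t c = (\<lambda>w. \<Sum>s\<in>t ` {..k}.
    (\<Sum>i<k. c i * ((if t (Suc i) = s then 1 else 0) - (if t i = s then 1 else 0))) * w s)"
    by (rule ext) (rule step_integral_eq_sum_times)
  show "gaussian_rv Q (step_integral k t c)"
    unfolding eq by (rule fam[OF _ times]) simp
  have "integrable Q (\<lambda>w. w s)" if "0 \<le> s" for s
    using gaussian_rv_integrable[OF fam[of "{s}" "\<lambda>_. 1"]] that by simp
  moreover have "(\<integral>w. w s \<partial>Q) = 0" if "0 \<le> s" for s
    using Q that by (simp add: centred_gaussian_process_def)
  ultimately show "(\<integral>w. step_integral k t c w \<partial>Q) = 0"
    unfolding step_integral_def using partition_of_mem(1)[OF part]
    by (subst Bochner_Integration.integral_sum) (auto simp: Suc_leI)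
qed

locale noise =
  fixes \<phi> :: "nat \<Rightarrow> real \<Rightarrow> real" and \<kappa> :: real and Q :: "(real \<Rightarrow> real) measure" and n :: nat
  assumes basis: "orthonormal_basis \<phi>" and admissible: "admissible_noise \<phi> \<kappa> Q" and n: "n \<ge> 1"
begin

abbreviation \<zeta> :: "nat \<Rightarrow> (real \<Rightarrow> real) \<Rightarrow> real" where
  "\<zeta> \<equiv> noise_coeff \<phi> Q n"

lemma centred: "centred_gaussian_process Q"
  using admissible by (simp add: admissible_noise_def)

lemma path_law: "path_law Q"
  using centred by (simp add: centred_gaussian_process_def)

sublocale prob_space Q
  using path_law by (simp add: path_law_def)

lemma basis_L2: "j \<ge> 1 \<Longrightarrow> \<phi> j \<in> L2_on (real n)"
  using basis by (intro periodic_L2_on) (simp add: orthonormal_basis_def)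

lemma stoch_integral_exists: "j \<ge> 1 \<Longrightarrow> \<exists>J. has_stoch_integral Q (real n) (\<phi> j) J"
  using admissible n basis_L2 by (simp add: admissible_noise_def)

lemma linear_gaussian:
  assumes "A \<subseteq> {1..k}"
  shows "gaussian_rv Q (\<lambda>w. \<Sum>j\<in>A. g j * \<zeta> j w)"
proof -
  have "gaussian_family Q {1..max k 1} \<zeta>"
    using admissible n by (simp add: admissible_noise_def)
  moreover have "finite A" "A \<subseteq> {1..max k 1}"
    using assms by (auto intro: finite_subset)
  ultimately show ?thesis by (simp add: gaussian_family_def)
qed

lemma noise_coeff_gaussian: "j \<ge> 1 \<Longrightarrow> gaussian_rv Q (\<zeta> j)"
  using linear_gaussian[of "{j}" j "\<lambda>_. 1"] by simp

lemma noise_coeff_centred: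
  assumes j: "j \<ge> 1"
  shows "expectation (\<zeta> j) = 0"
proof -
  let ?J = "stoch_integral Q (real n) (\<phi> j)"
  have T: "0 < real n" using n by simp
  have J: "has_stoch_integral Q (real n) (\<phi> j) ?J"
    by (rule has_stoch_integral_stoch_integral[OF stoch_integral_exists[OF j]])
  have "gaussian_rv Q (\<lambda>w. \<Sum>i\<in>{j}. sqrt (real n) * \<zeta> i w)"
    by (rule linear_gaussian[of _ j]) (use j in auto)
  then have gauss: "gaussian_rv Q ?J"
    using T by (simp add: noise_coeff_def)
  have "expectation ?J = 0"
  proof (rule gaussian_limit_centred[OF gauss])
    fix \<epsilon> :: real assume "\<epsilon> > 0"
    then obtain \<delta> where "\<delta> > 0" and \<delta>: "\<And>k t c. partition_of (real n) k t \<Longrightarrow>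
        norm_L2 (real n) (\<lambda>x. step_fun k t c x - \<phi> j x) < \<delta> \<Longrightarrow>
        measure Q {w \<in> space Q. \<bar>step_integral k t c w - ?J w\<bar> > \<epsilon>} < \<epsilon>"
      by (rule has_stoch_integral_approx[OF J]) (rule that)
    obtain k t c where part: "partition_of (real n) k t"
      and close: "norm_L2 (real n) (\<lambda>x. step_fun k t c x - \<phi> j x) < \<delta>"
      using step_fun_dense[OF T basis_L2[OF j] \<open>\<delta> > 0\<close>] by blast
    show "\<exists>X. gaussian_rv Q X \<and> expectation X = 0 \<and> measure Q {w \<in> space Q. \<bar>X w - ?J w\<bar> > \<epsilon>} < \<epsilon>"
      using step_integral_gaussian[OF centred part] \<delta>[OF part close] by blast
  qed
  then show ?thesis by (simp add: noise_coeff_def[abs_def])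
qed

lemma noise_coeff_mult_integrable:
  assumes "i \<ge> 1" "j \<ge> 1"
  shows "integrable Q (\<lambda>w. \<zeta> i w * \<zeta> j w)"
proof (rule Bochner_Integration.integrable_bound)
  show "integrable Q (\<lambda>w. (\<zeta> i w)\<^sup>2 + (\<zeta> j w)\<^sup>2)"
    using assms by (intro Bochner_Integration.integrable_add gaussian_rv_square_integrable noise_coeff_gaussian)
  show "(\<lambda>w. \<zeta> i w * \<zeta> j w) \<in> borel_measurable Q"
    using assms by (intro borel_measurable_times gaussian_rv_measurable noise_coeff_gaussian)
  show "AE w in Q. norm (\<zeta> i w * \<zeta> j w) \<le> norm ((\<zeta> i w)\<^sup>2 + (\<zeta> j w)\<^sup>2)"
    using abs_mult_le_sum_squares by auto
qed

lemma noise_cov_eq: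
  "noise_cov \<phi> Q k n = Matrix.mat k k (\<lambda>(i, j). expectation (\<lambda>w. \<zeta> (Suc i) w * \<zeta> (Suc j) w))"
  unfolding noise_cov_def cov_def by (simp add: noise_coeff_centred)

lemma noise_cov_form:
  assumes "v \<in> carrier_vec k" "u \<in> carrier_vec k"
  shows "v \<bullet> (noise_cov \<phi> Q k n *\<^sub>v u)
    = (\<Sum>i<k. \<Sum>j<k. v $ i * u $ j * expectation (\<lambda>w. \<zeta> (Suc i) w * \<zeta> (Suc j) w))"
  using assms by (simp add: noise_cov_eq scalar_prod_def lessThan_atLeast0 sum_distrib_left mult_ac)

lemma linear_second_moment:
  "expectation (\<lambda>w. (\<Sum>j=1..k. g j * \<zeta> j w)\<^sup>2) \<le> \<kappa> * (\<Sum>j=1..k. (g j)\<^sup>2)"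
proof (cases "k = 0")
  case False
  let ?B = "noise_cov \<phi> Q k n"
  define v where "v = Matrix.vec k (\<lambda>i. g (Suc i))"
  have v: "v \<in> carrier_vec k" by (simp add: v_def)
  have B: "?B \<in> carrier_mat k k" by (simp add: noise_cov_def)
  have shift: "(\<Sum>j=1..k. h j) = (\<Sum>i<k. h (Suc i))" for h :: "nat \<Rightarrow> real"
    by (rule sum.reindex_bij_witness[of _ Suc "\<lambda>j. j - 1"]) auto
  have "v \<bullet> (?B *\<^sub>v v) = (\<Sum>i<k. \<Sum>j<k. expectation (\<lambda>w. (g (Suc i) * \<zeta> (Suc i) w) * (g (Suc j) * \<zeta> (Suc j) w)))"
    unfolding noise_cov_form[OF v v]
  proof (intro sum.cong refl)
    fix i j assume "i \<in> {..<k}" "j \<in> {..<k}"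
    moreover have "expectation (\<lambda>w. (g (Suc i) * \<zeta> (Suc i) w) * (g (Suc j) * \<zeta> (Suc j) w))
      = expectation (\<lambda>w. (g (Suc i) * g (Suc j)) * (\<zeta> (Suc i) w * \<zeta> (Suc j) w))"
      by (simp add: mult_ac)
    ultimately show "v $ i * v $ j * expectation (\<lambda>w. \<zeta> (Suc i) w * \<zeta> (Suc j) w)
      = expectation (\<lambda>w. (g (Suc i) * \<zeta> (Suc i) w) * (g (Suc j) * \<zeta> (Suc j) w))"
      by (simp add: v_def)
  qed
  also have "\<dots> = expectation (\<lambda>w. \<Sum>i<k. \<Sum>j<k. (g (Suc i) * \<zeta> (Suc i) w) * (g (Suc j) * \<zeta> (Suc j) w))"
  proof -
    have "integrable Q (\<lambda>w. (g (Suc i) * \<zeta> (Suc i) w) * (g (Suc j) * \<zeta> (Suc j) w))" for i j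
      using integrable_mult_right[OF noise_coeff_mult_integrable[of "Suc i" "Suc j"], of "g (Suc i) * g (Suc j)"]
      by (simp add: mult_ac)
    then show ?thesis
      by (simp add: Bochner_Integration.integral_sum Bochner_Integration.integrable_sum)
  qed
  also have "\<dots> = expectation (\<lambda>w. (\<Sum>j=1..k. g j * \<zeta> j w)\<^sup>2)"
    by (simp only: shift power2_eq_square sum_product)
  finally have form: "v \<bullet> (?B *\<^sub>v v) = expectation (\<lambda>w. (\<Sum>j=1..k. g j * \<zeta> j w)\<^sup>2)" .
  have sym: "x \<bullet> (?B *\<^sub>v y) = y \<bullet> (?B *\<^sub>v x)" if "x \<in> carrier_vec k" "y \<in> carrier_vec k" for x y
    unfolding noise_cov_form[OF that] noise_cov_form[OF that(2) that(1)]
    by (subst sum.swap) (simp add: mult_ac)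
  have vv: "v \<bullet> v = (\<Sum>j=1..k. (g j)\<^sup>2)"
    by (simp only: shift) (simp add: v_def scalar_prod_def power2_eq_square lessThan_atLeast0)
  have "lambda_max ?B \<le> \<kappa>"
    using admissible n False unfolding admissible_noise_def by (metis One_nat_def Suc_leI neq0_conv order_trans)
  then have "lambda_max ?B * (v \<bullet> v) \<le> \<kappa> * (v \<bullet> v)"
    by (rule mult_right_mono) (rule scalar_prod_self_nonneg)
  with quadratic_form_le_lambda_max[OF B _ sym v] False show ?thesis
    by (simp add: form vv)
qed simp

lemma noise_coeff_second_moment:
  assumes "j \<ge> 1"
  shows "expectation (\<lambda>w. (\<zeta> j w)\<^sup>2) \<le> \<kappa>"
proof -
  have *: "(\<Sum>i=1..j. (if i = j then 1 else 0) * \<zeta> i w) = \<zeta> j w" for w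
    using assms by (simp add: if_distrib[of "\<lambda>x. x * _"] cong: if_cong)
  have "(\<Sum>i=1..j. (if i = j then 1 else 0 :: real)\<^sup>2) = 1"
    using assms by (simp add: if_distrib[of "\<lambda>x. x\<^sup>2"] cong: if_cong)
  then show ?thesis
    using linear_second_moment[where k=j and g="\<lambda>i. if i = j then 1 else 0"] by (simp only: *)
qed

text \<open>Positivity of \<open>\<kappa>\<close> is where non-degeneracy of the covariance enters.\<close>

lemma kappa_pos: "\<kappa> > 0"
proof -
  have "Determinant.det (noise_cov \<phi> Q 1 n) \<noteq> 0"
    using admissible n by (simp add: admissible_noise_def)
  then have "expectation (\<lambda>w. (\<zeta> 1 w)\<^sup>2) \<noteq> 0"
    by (simp add: noise_cov_eq det_single power2_eq_square)
  moreover have "0 \<le> expectation (\<lambda>w. (\<zeta> 1 w)\<^sup>2)"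
    by (rule Bochner_Integration.integral_nonneg) simp
  ultimately have "0 < expectation (\<lambda>w. (\<zeta> 1 w)\<^sup>2)"
    by linarith
  also have "\<dots> \<le> \<kappa>"
    by (rule noise_coeff_second_moment) simp
  finally show ?thesis .
qed

lemma noise_exp_moment:
  "(\<integral>\<^sup>+w. ennreal (exp ((\<Sum>j=1..a. (\<zeta> j w)\<^sup>2) / (4 * \<kappa>))) \<partial>Q) \<le> ennreal (sqrt 2 ^ a)"
proof -
  have "(\<integral>\<^sup>+w. ennreal (exp ((\<Sum>j\<in>{1..a}. (\<zeta> j w)\<^sup>2) / (4 * \<kappa>))) \<partial>Q) \<le> ennreal (sqrt 2 ^ card {1..a})"
  proof (rule exp_square_sum_moment)
    show "\<zeta> j \<in> borel_measurable Q" if "j \<in> {1..a}" for j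
      using that by (intro gaussian_rv_measurable noise_coeff_gaussian) simp
    fix g :: "nat \<Rightarrow> real"
    let ?L = "\<lambda>w. \<Sum>j=1..a. g j * \<zeta> j w"
    have L: "gaussian_rv Q ?L" by (rule linear_gaussian[of _ a]) simp
    have "expectation ?L = 0"
      using noise_coeff_gaussian gaussian_rv_integrable noise_coeff_centred
      by (subst Bochner_Integration.integral_sum) auto
    from gaussian_rv_exp_moment[OF L this]
    show "(\<integral>\<^sup>+w. ennreal (exp (?L w)) \<partial>Q) \<le> ennreal (exp (\<kappa> / 2 * (\<Sum>j=1..a. (g j)\<^sup>2)))"
      using linear_second_moment[of g a] by (simp add: ennreal_leI)
  qed (use kappa_pos in auto)
  then show ?thesis by simp
qed

end

lemma z_star_gt_one: "z_star > 1"
proof -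
  have *: "ln (x::real) - x + 2 < ln y - y + 2" if "1 < y" "y < x" for x y
  proof (rule DERIV_neg_imp_decreasing[OF that(2)])
    fix z assume "y \<le> z" "z \<le> x"
    then show "\<exists>d. ((\<lambda>x. ln x - x + 2) has_real_derivative d) (at z) \<and> d < 0"
      using that by (intro exI[of _ "1 / z - 1"]) (auto intro!: derivative_eq_intros simp: field_simps)
  qed
  have "\<exists>z\<ge>3. z \<le> (4::real) \<and> ln z - z + 2 = 0"
  proof (rule IVT2)
    have "ln (exp 1) \<le> ln (3::real)"
      using exp_le by (subst ln_le_cancel_iff) auto
    then show "0 \<le> ln (3::real) - 3 + 2" by simp
    have "(4::real) = 2\<^sup>2" by simp
    then have "ln (4::real) = 2 * ln 2" by (simp only: ln_realpow)
    moreover have "ln (2::real) \<le> 2 - 1" by (rule ln_le_minus_one) simp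
    ultimately show "ln (4::real) - 4 + 2 \<le> 0" by simp
  qed (auto intro!: continuous_intros)
  then obtain z :: real where z: "z \<ge> 3" "ln z = z - 2" by auto
  have "z_star = z"
    unfolding z_star_def
  proof (rule Greatest_equality)
    show "0 < z \<and> ln z = z - 2" using z by simp
    show "y \<le> z" if "0 < y \<and> ln y = y - 2" for y
      using *[of z y] z that by (cases "y \<le> z") auto
  qed
  then show ?thesis using z by simp
qed

lemma penalty_factor_ge: "4 \<le> z_star\<^sup>2 / (z_star - 1)"
proof -
  have "0 \<le> (z_star - 2)\<^sup>2" by simp
  then show ?thesis using z_star_gt_one
    by (simp add: field_simps power2_diff)
qed

section \<open>The selected model\<close>

lemma sum_split_at:
  fixes f :: "nat \<Rightarrow> real"
  assumes "a \<le> b"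
  shows "(\<Sum>j=1..b. f j) = (\<Sum>j=1..a. f j) + (\<Sum>j\<in>{a<..b}. f j)"
proof -
  have eq: "{1..b} = {1..a} \<union> {a<..b}" using assms by auto
  show ?thesis unfolding eq by (rule sum.union_disjoint) auto
qed

lemma ordered_selection_bound:
  fixes s e T :: "nat \<Rightarrow> real" and K \<kappa> W :: real
  assumes \<kappa>: "0 \<le> \<kappa>" "16 * \<kappa> \<le> K" and n: "0 < n"
    and sel: "1 \<le> l" "l \<le> n"
    and opt: "(\<Sum>j=1..i. (s j + e j)\<^sup>2) - K * (real i / real n)
      \<le> (\<Sum>j=1..l. (s j + e j)\<^sup>2) - K * (real l / real n)"
    and W: "0 \<le> W" "\<And>a. 1 \<le> a \<Longrightarrow> a \<le> n \<Longrightarrow> (\<Sum>j=1..a. (e j)\<^sup>2) \<le> W + 4 * \<kappa> * (real a / real n)"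
    and T: "\<And>a. 0 \<le> T a" "\<And>a b. a \<le> b \<Longrightarrow> T a = T b + (\<Sum>j\<in>{a<..b}. (s j)\<^sup>2)"
  shows "(\<Sum>j=1..l. (e j)\<^sup>2) + T l
    \<le> 3 * (\<Sum>j=1..i. (e j)\<^sup>2) + 2 * T i + 2 * W + 2 * K * (real i / real n)"
proof -
  have sq: "(x + y)\<^sup>2 \<le> 2 * x\<^sup>2 + 2 * y\<^sup>2" for x y :: real
    using zero_le_power2[of "x - y"] by (simp add: power2_sum power2_diff)
  have nonneg: "0 \<le> (\<Sum>j\<in>A. (f j)\<^sup>2)" for A and f :: "nat \<Rightarrow> real"
    by (rule sum_nonneg) simp
  have K: "0 \<le> K" using \<kappa> by linarith
  have Kl: "0 \<le> K * (real l / real n)" "0 \<le> K * (real i / real n)" using K by simp_all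
  show ?thesis
  proof (cases "l \<le> i")
    case True
    have "(\<Sum>j\<in>{l<..i}. (s j)\<^sup>2) \<le> (\<Sum>j\<in>{l<..i}. 2 * (s j + e j)\<^sup>2 + 2 * (e j)\<^sup>2)"
    proof (rule sum_mono)
      fix j show "(s j)\<^sup>2 \<le> 2 * (s j + e j)\<^sup>2 + 2 * (e j)\<^sup>2"
        using sq[of "s j + e j" "- e j"] by simp
    qed
    then have "(\<Sum>j\<in>{l<..i}. (s j)\<^sup>2) \<le> 2 * (\<Sum>j\<in>{l<..i}. (s j + e j)\<^sup>2) + 2 * (\<Sum>j\<in>{l<..i}. (e j)\<^sup>2)"
      by (simp add: sum.distrib sum_distrib_left)
    moreover have "(\<Sum>j\<in>{l<..i}. (s j + e j)\<^sup>2) \<le> K * (real i / real n)"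
      using opt Kl unfolding sum_split_at[OF True, of "\<lambda>j. (s j + e j)\<^sup>2"] by linarith
    ultimately show ?thesis
      using T(2)[OF True] T(1)[of i] W(1) sum_split_at[OF True, of "\<lambda>j. (e j)\<^sup>2"]
        nonneg[of e "{1..l}"] nonneg[of e "{l<..i}"] by linarith
  next
    case False
    then have il: "i \<le> l" by simp
    have "(\<Sum>j\<in>{i<..l}. (s j + e j)\<^sup>2) \<le> (\<Sum>j\<in>{i<..l}. 2 * (s j)\<^sup>2 + 2 * (e j)\<^sup>2)"
      by (rule sum_mono) (rule sq)
    then have "(\<Sum>j\<in>{i<..l}. (s j + e j)\<^sup>2) \<le> 2 * (\<Sum>j\<in>{i<..l}. (s j)\<^sup>2) + 2 * (\<Sum>j\<in>{i<..l}. (e j)\<^sup>2)"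
      by (simp add: sum.distrib sum_distrib_left)
    moreover have "K * (real l / real n) - K * (real i / real n) \<le> (\<Sum>j\<in>{i<..l}. (s j + e j)\<^sup>2)"
      using opt unfolding sum_split_at[OF il, of "\<lambda>j. (s j + e j)\<^sup>2"] by linarith
    moreover have "16 * \<kappa> * (real l / real n) \<le> K * (real l / real n)"
      using \<kappa>(2) by (intro mult_right_mono) auto
    ultimately show ?thesis
      using T(2)[OF il] T(1)[of l] W(1) W(2)[OF sel] sum_split_at[OF il, of "\<lambda>j. (e j)\<^sup>2"]
        nonneg[of e "{1..i}"] nonneg[of s "{i<..l}"] Kl by linarith
  qed
qed

lemma contrast_lse:
  assumes \<phi>: "orthonormal_basis \<phi>" and n: "n \<ge> 1"
  shows "contrast \<phi> n M y {1..i} (coeff_est \<phi> n M y) = - (\<Sum>j=1..i. (coeff_est \<phi> n M y j)\<^sup>2)"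
proof -
  let ?a = "coeff_est \<phi> n M y"
  have z: "inner_L2 1 (\<lambda>t. 0) f = 0" for f by (simp add: inner_L2_def set_lebesgue_integral_def)
  have "(norm_L2 1 (\<lambda>t. \<Sum>j=1..i. ?a j * \<phi> j t))\<^sup>2 = (norm_L2 1 (\<lambda>t. 0 - (\<Sum>j=1..i. ?a j * \<phi> j t)))\<^sup>2"
    unfolding norm_L2_def inner_L2_def by simp
  also have "\<dots> = (\<Sum>j=1..i. (?a j)\<^sup>2)"
    using norm_L2_diff_orthonormal_sum[OF \<phi> L2_on_zero, where n=i and a="?a"]
    by (simp add: z norm_L2_square)
  finally have norm: "(norm_L2 1 (\<lambda>t. \<Sum>j=1..i. ?a j * \<phi> j t))\<^sup>2 = (\<Sum>j=1..i. (?a j)\<^sup>2)" .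
  have "2 / real n * (\<Sum>j=1..i. ?a j * stoch_integral M (real n) (\<phi> j) y) = 2 * (\<Sum>j=1..i. (?a j)\<^sup>2)"
    unfolding sum_distrib_left using n
    by (intro sum.cong refl) (simp add: coeff_est_def power2_eq_square)
  then show ?thesis by (simp only: contrast_def norm)
qed

lemma selected_model_optimal:
  assumes \<phi>: "orthonormal_basis \<phi>" and n: "n \<ge> 1"
  obtains l where "1 \<le> l" "l \<le> n" "selected_model \<phi> \<kappa> n M y = {1..l}"
    "\<And>i. 1 \<le> i \<Longrightarrow> i \<le> n \<Longrightarrow>
      (\<Sum>j=1..i. (coeff_est \<phi> n M y j)\<^sup>2) - 4 * \<kappa> * (z_star\<^sup>2 / (z_star - 1)) * (real i / real n)
      \<le> (\<Sum>j=1..l. (coeff_est \<phi> n M y j)\<^sup>2) - 4 * \<kappa> * (z_star\<^sup>2 / (z_star - 1)) * (real l / real n)"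
proof -
  define f where "f m = contrast \<phi> n M y m (coeff_est \<phi> n M y) + penalty \<kappa> n m" for m
  have f: "f {1..i} = - (\<Sum>j=1..i. (coeff_est \<phi> n M y j)\<^sup>2)
      + 4 * \<kappa> * (z_star\<^sup>2 / (z_star - 1)) * (real i / real n)" for i
    by (simp add: f_def contrast_lse[OF \<phi> n, simplified] penalty_def)
  have fin: "finite (models n)" "models n \<noteq> {}"
    using n by (auto simp: models_def)
  have sel: "selected_model \<phi> \<kappa> n M y = arg_min_on f (models n)"
    by (simp add: selected_model_def f_def[abs_def])
  obtain l where l: "l \<in> {1..n}" "selected_model \<phi> \<kappa> n M y = {1..l}"
    using arg_min_if_finite(1)[OF fin, of f] unfolding sel models_def by blast
  have "f {1..l} \<le> f {1..i}" if "1 \<le> i" "i \<le> n" for i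
  proof -
    have "{1..i} \<in> models n" using that by (auto simp: models_def)
    then show ?thesis
      using arg_min_if_finite(2)[OF fin, of f] l(2) unfolding sel by (metis not_less)
  qed
  then show thesis
    using l unfolding f by (intro that[of l]) fastforce+
qed

context noise
begin

lemma noise_nn_integral_bound:
  assumes c: "0 \<le> c0" "0 \<le> c1" "0 \<le> c2"
  shows "(\<integral>\<^sup>+w. ennreal (c0 + c1 * (\<Sum>j=1..i. (\<zeta> j w)\<^sup>2)
      + c2 * (\<Sum>a=1..m. exp ((\<Sum>j=1..a. (\<zeta> j w)\<^sup>2) / (4 * \<kappa>) - real a))) \<partial>Q)
    \<le> ennreal (c0 + c1 * (real i * \<kappa>) + c2 * 4)"
proof -
  let ?X = "\<lambda>a w. (\<Sum>j=1..a. (\<zeta> j w)\<^sup>2) / (4 * \<kappa>)"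
  have [measurable]: "\<zeta> j \<in> borel_measurable Q" if "j \<ge> 1" for j
    using that by (intro gaussian_rv_measurable noise_coeff_gaussian)
  have Xm[measurable]: "?X a \<in> borel_measurable Q" for a
    by (intro borel_measurable_divide borel_measurable_sum borel_measurable_power) auto
  have 1: "(\<integral>\<^sup>+w. ennreal (c1 * (\<Sum>j=1..i. (\<zeta> j w)\<^sup>2)) \<partial>Q) \<le> ennreal (c1 * (real i * \<kappa>))"
  proof -
    have int: "integrable Q (\<lambda>w. (\<zeta> j w)\<^sup>2)" if "j \<in> {1..i}" for j
      using that by (intro gaussian_rv_square_integrable noise_coeff_gaussian) simp
    have "(\<integral>\<^sup>+w. ennreal (c1 * (\<Sum>j=1..i. (\<zeta> j w)\<^sup>2)) \<partial>Q) = ennreal (expectation (\<lambda>w. c1 * (\<Sum>j=1..i. (\<zeta> j w)\<^sup>2)))"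
      using c int by (intro nn_integral_eq_integral) (auto intro!: sum_nonneg mult_nonneg_nonneg)
    also have "expectation (\<lambda>w. c1 * (\<Sum>j=1..i. (\<zeta> j w)\<^sup>2)) = c1 * (\<Sum>j=1..i. expectation (\<lambda>w. (\<zeta> j w)\<^sup>2))"
      using int by (simp add: Bochner_Integration.integral_sum)
    also have "\<dots> \<le> c1 * (real i * \<kappa>)"
      using sum_mono[of "{1..i}" "\<lambda>j. expectation (\<lambda>w. (\<zeta> j w)\<^sup>2)" "\<lambda>_. \<kappa>"] noise_coeff_second_moment c
      by (intro mult_left_mono) auto
    finally show ?thesis by (simp add: ennreal_leI)
  qed
  have 2: "(\<integral>\<^sup>+w. ennreal (c2 * (\<Sum>a=1..m. exp (?X a w - real a))) \<partial>Q) \<le> ennreal (c2 * 4)"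
  proof -
    have "(\<integral>\<^sup>+w. ennreal (c2 * (\<Sum>a=1..m. exp (?X a w - real a))) \<partial>Q)
        = (\<integral>\<^sup>+w. (\<Sum>a=1..m. ennreal (c2 * exp (- real a)) * ennreal (exp (?X a w))) \<partial>Q)"
    proof (rule nn_integral_cong)
      fix w
      have "c2 * exp (?X a w - real a) = c2 * exp (- real a) * exp (?X a w)" for a
        by (simp only: mult.assoc exp_add[symmetric]) simp
      then have "c2 * (\<Sum>a=1..m. exp (?X a w - real a)) = (\<Sum>a=1..m. c2 * exp (- real a) * exp (?X a w))"
        unfolding sum_distrib_left by (intro sum.cong refl)
      also have "ennreal \<dots> = (\<Sum>a=1..m. ennreal (c2 * exp (- real a) * exp (?X a w)))"
        using c by (intro sum_ennreal[symmetric]) simp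
      also have "\<dots> = (\<Sum>a=1..m. ennreal (c2 * exp (- real a)) * ennreal (exp (?X a w)))"
        using c by (intro sum.cong refl ennreal_mult) simp_all
      finally show "ennreal (c2 * (\<Sum>a=1..m. exp (?X a w - real a)))
          = (\<Sum>a=1..m. ennreal (c2 * exp (- real a)) * ennreal (exp (?X a w)))" .
    qed
    also have "\<dots> = (\<Sum>a=1..m. ennreal (c2 * exp (- real a)) * (\<integral>\<^sup>+w. ennreal (exp (?X a w)) \<partial>Q))"
      using Xm by (subst nn_integral_sum) (auto intro!: sum.cong nn_integral_cmult)
    also have "\<dots> \<le> (\<Sum>a=1..m. ennreal (c2 * exp (- real a)) * ennreal (sqrt 2 ^ a))"
      by (intro sum_mono mult_left_mono noise_exp_moment) auto
    also have "\<dots> = ennreal (\<Sum>a=1..m. c2 * (exp (- real a) * sqrt 2 ^ a))"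
    proof -
      have "ennreal (c2 * exp (- real a)) * ennreal (sqrt 2 ^ a) = ennreal (c2 * (exp (- real a) * sqrt 2 ^ a))" for a
        using c by (subst ennreal_mult[symmetric]) (auto simp: mult.assoc)
      then show ?thesis
        using c by (simp only:) (intro sum_ennreal, simp)
    qed
    also have "\<dots> \<le> ennreal (c2 * 4)"
    proof (rule ennreal_leI)
      have "exp (- real a) * sqrt 2 ^ a \<le> (3/4) ^ a" for a
      proof -
        have "2 \<le> exp (1::real)" using exp_ge_add_one_self[of 1] by simp
        then have "exp (-1) \<le> 1 / (2::real)"
          by (simp add: exp_minus field_simps)
        moreover have "sqrt 2 \<le> 3 / 2"
          by (rule real_le_lsqrt) (auto simp: power2_eq_square)
        ultimately have "exp (-1) * sqrt 2 \<le> 1 / 2 * (3 / 2)"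
          by (intro mult_mono) auto
        then have "(exp (-1) * sqrt 2) ^ a \<le> (3/4) ^ a"
          by (intro power_mono) auto
        moreover have "exp (- real a) = exp (-1) ^ a"
          by (simp add: exp_of_nat_mult[symmetric])
        ultimately show ?thesis by (simp add: power_mult_distrib)
      qed
      then have "(\<Sum>a=1..m. c2 * (exp (- real a) * sqrt 2 ^ a)) \<le> (\<Sum>a=1..m. c2 * (3/4) ^ a)"
        using c by (intro sum_mono mult_left_mono) auto
      also have "\<dots> \<le> c2 * (\<Sum>a. (3/4) ^ a)"
        unfolding sum_distrib_left[symmetric] using c
        by (intro mult_left_mono sum_le_suminf summable_geometric) auto
      also have "(\<Sum>a. (3/4 :: real) ^ a) = 4"
        by (subst suminf_geometric) auto
      finally show "(\<Sum>a=1..m. c2 * (exp (- real a) * sqrt 2 ^ a)) \<le> c2 * 4" .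
    qed
    finally show ?thesis .
  qed
  have "(\<integral>\<^sup>+w. ennreal (c0 + c1 * (\<Sum>j=1..i. (\<zeta> j w)\<^sup>2) + c2 * (\<Sum>a=1..m. exp (?X a w - real a))) \<partial>Q)
      = (\<integral>\<^sup>+w. ennreal c0 + (ennreal (c1 * (\<Sum>j=1..i. (\<zeta> j w)\<^sup>2)) + ennreal (c2 * (\<Sum>a=1..m. exp (?X a w - real a)))) \<partial>Q)"
    using c by (intro nn_integral_cong) (simp add: ennreal_plus[symmetric] sum_nonneg add.assoc del: ennreal_plus)
  also have "\<dots> = ennreal c0 + ((\<integral>\<^sup>+w. ennreal (c1 * (\<Sum>j=1..i. (\<zeta> j w)\<^sup>2)) \<partial>Q)
      + (\<integral>\<^sup>+w. ennreal (c2 * (\<Sum>a=1..m. exp (?X a w - real a))) \<partial>Q))"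
  proof -
    have [measurable]: "(\<lambda>w. \<Sum>j=1..i. (\<zeta> j w)\<^sup>2) \<in> borel_measurable Q"
      by (intro borel_measurable_sum borel_measurable_power) auto
    show ?thesis by (simp add: nn_integral_add emeasure_space_1)
  qed
  also have "\<dots> \<le> ennreal c0 + (ennreal (c1 * (real i * \<kappa>)) + ennreal (c2 * 4))"
    by (intro add_left_mono add_mono 1 2)
  also have "\<dots> = ennreal (c0 + c1 * (real i * \<kappa>) + c2 * 4)"
    using c kappa_pos by (simp add: ennreal_plus[symmetric] add.assoc del: ennreal_plus)
  finally show ?thesis .
qed

lemma coeff_est_obs_law:
  assumes S: "S \<in> periodic_L2" "continuous_on UNIV S" and j: "j \<ge> 1"
  shows "AE y in obs_law S Q. coeff_est \<phi> n (obs_law S Q) y j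
    = inner_L2 1 S (\<phi> j) + \<zeta> j (observe (\<lambda>s. - S s) y) / sqrt (real n)"
proof -
  have T: "0 < real n" using n by simp
  have "inner_L2 (real n) (\<phi> j) S = real n * inner_L2 1 S (\<phi> j)"
    using periodic_inner_L2[OF _ S(1), of "\<phi> j" n] basis j
    by (simp add: orthonormal_basis_def inner_L2_commute)
  note inner = this
  from stoch_integral_obs_law[OF path_law S(2) T basis_L2[OF j] stoch_integral_exists[OF j]]
  show ?thesis
    by eventually_elim (use T in \<open>simp add: coeff_est_def noise_coeff_def inner add_divide_distrib\<close>)
qed

lemma loss_bound:
  assumes S: "S \<in> periodic_L2" "continuous_on UNIV S" and i: "1 \<le> i" "i \<le> n"
  defines "K \<equiv> 4 * \<kappa> * (z_star\<^sup>2 / (z_star - 1))"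
  shows "AE y in obs_law S Q.
    (norm_L2 1 (\<lambda>t. \<omega> * (model_selection_est \<phi> \<kappa> n (obs_law S Q) y t - S t)))\<^sup>2
    \<le> (let w = observe (\<lambda>s. - S s) y in
        \<omega>\<^sup>2 * (2 * tail_energy \<phi> S (Suc i) + 2 * K * (real i / real n))
        + 3 * \<omega>\<^sup>2 / real n * (\<Sum>j=1..i. (\<zeta> j w)\<^sup>2)
        + 8 * \<kappa> * \<omega>\<^sup>2 / real n * (\<Sum>a=1..n. exp ((\<Sum>j=1..a. (\<zeta> j w)\<^sup>2) / (4 * \<kappa>) - real a)))"
proof -
  let ?M = "obs_law S Q"
  have "AE y in ?M. \<forall>j\<in>{1..}. coeff_est \<phi> n ?M y j
      = inner_L2 1 S (\<phi> j) + \<zeta> j (observe (\<lambda>s. - S s) y) / sqrt (real n)"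
    by (subst AE_ball_countable) (auto intro: coeff_est_obs_law[OF S])
  then show ?thesis
  proof eventually_elim
    fix y assume "\<forall>j\<in>{1..}. coeff_est \<phi> n ?M y j
      = inner_L2 1 S (\<phi> j) + \<zeta> j (observe (\<lambda>s. - S s) y) / sqrt (real n)"
    define w where "w = observe (\<lambda>s. - S s) y"
    define s where "s j = inner_L2 1 S (\<phi> j)" for j
    define e where "e j = \<zeta> j w / sqrt (real n)" for j
    define W where "W = 4 * \<kappa> / real n * (\<Sum>a=1..n. exp ((\<Sum>j=1..a. (\<zeta> j w)\<^sup>2) / (4 * \<kappa>) - real a))"
    have coeff: "coeff_est \<phi> n ?M y j = s j + e j" if "j \<ge> 1" for j
      using \<open>\<forall>j\<in>{1..}. _\<close> that by (simp add: s_def e_def w_def)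
    have n0: "0 < real n" using n by simp
    have \<kappa>: "0 < \<kappa>" by (rule kappa_pos)
    have e_sum: "(\<Sum>j=1..a. (e j)\<^sup>2) = (\<Sum>j=1..a. (\<zeta> j w)\<^sup>2) / real n" for a
      using n0 by (simp add: e_def power_divide sum_divide_distrib)
    have coeff_sum: "(\<Sum>j=1..a. (coeff_est \<phi> n ?M y j)\<^sup>2) = (\<Sum>j=1..a. (s j + e j)\<^sup>2)" for a
      by (intro sum.cong refl) (simp add: coeff)
    obtain l where l: "1 \<le> l" "l \<le> n" "selected_model \<phi> \<kappa> n ?M y = {1..l}"
      and opt: "(\<Sum>j=1..i. (s j + e j)\<^sup>2) - K * (real i / real n) \<le> (\<Sum>j=1..l. (s j + e j)\<^sup>2) - K * (real l / real n)"
      by (rule selected_model_optimal[OF basis n, of \<kappa> ?M y]) (use i in \<open>auto simp only: coeff_sum K_def\<close>)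
    have "(norm_L2 1 (\<lambda>t. \<omega> * (model_selection_est \<phi> \<kappa> n ?M y t - S t)))\<^sup>2
        = \<omega>\<^sup>2 * (norm_L2 1 (\<lambda>t. (\<Sum>j=1..l. coeff_est \<phi> n ?M y j * \<phi> j t) - S t))\<^sup>2"
      unfolding norm_L2_scale by (simp add: model_selection_est_def lse_def l(3))
    also have "\<dots> = \<omega>\<^sup>2 * ((\<Sum>j=1..l. (coeff_est \<phi> n ?M y j - s j)\<^sup>2) + tail_energy \<phi> S (Suc l))"
      unfolding projection_error[OF basis S(1)] s_def ..
    also have "(\<Sum>j=1..l. (coeff_est \<phi> n ?M y j - s j)\<^sup>2) = (\<Sum>j=1..l. (e j)\<^sup>2)"
      by (intro sum.cong refl) (simp add: coeff)
    also have "\<omega>\<^sup>2 * ((\<Sum>j=1..l. (e j)\<^sup>2) + tail_energy \<phi> S (Suc l))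
        \<le> \<omega>\<^sup>2 * (3 * (\<Sum>j=1..i. (e j)\<^sup>2) + 2 * tail_energy \<phi> S (Suc i) + 2 * W + 2 * K * (real i / real n))"
    proof (rule mult_left_mono[OF ordered_selection_bound[where T="\<lambda>a. tail_energy \<phi> S (Suc a)" and s=s and \<kappa>=\<kappa>]])
      show "16 * \<kappa> \<le> K"
        using mult_left_mono[OF penalty_factor_ge, of "4 * \<kappa>"] \<kappa> by (simp add: K_def)
      show "0 \<le> W" using \<kappa> by (simp add: W_def sum_nonneg)
      fix a assume a: "1 \<le> a" "a \<le> n"
      let ?X = "\<lambda>a. \<Sum>j=1..a. (\<zeta> j w)\<^sup>2"
      have "?X a / (4 * \<kappa>) - real a \<le> exp (?X a / (4 * \<kappa>) - real a)"
        using exp_ge_add_one_self[of "?X a / (4 * \<kappa>) - real a"] by linarith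
      also have "\<dots> \<le> (\<Sum>a=1..n. exp (?X a / (4 * \<kappa>) - real a))"
        using a by (intro member_le_sum) auto
      finally have "4 * \<kappa> / real n * (?X a / (4 * \<kappa>) - real a) \<le> W"
        unfolding W_def using \<kappa> n0 by (intro mult_left_mono) auto
      moreover have "4 * \<kappa> / real n * (?X a / (4 * \<kappa>) - real a) = ?X a / real n - 4 * \<kappa> * (real a / real n)"
        using \<kappa> n0 by (simp add: field_simps)
      ultimately show "(\<Sum>j=1..a. (e j)\<^sup>2) \<le> W + 4 * \<kappa> * (real a / real n)"
        unfolding e_sum by linarith
    next
      fix a b :: nat assume "a \<le> b"
      then show "tail_energy \<phi> S (Suc a) = tail_energy \<phi> S (Suc b) + (\<Sum>j\<in>{a<..b}. (s j)\<^sup>2)"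
        using norm_L2_eq_tail_energy[OF basis S(1), of a] norm_L2_eq_tail_energy[OF basis S(1), of b]
          sum_split_at[of a b "\<lambda>j. (s j)\<^sup>2"] unfolding s_def by linarith
    qed (use \<kappa> n l opt tail_energy_nonneg[OF basis S(1)] in auto)
    also have "\<dots> = \<omega>\<^sup>2 * (2 * tail_energy \<phi> S (Suc i) + 2 * K * (real i / real n))
        + 3 * \<omega>\<^sup>2 / real n * (\<Sum>j=1..i. (\<zeta> j w)\<^sup>2)
        + 8 * \<kappa> * \<omega>\<^sup>2 / real n * (\<Sum>a=1..n. exp ((\<Sum>j=1..a. (\<zeta> j w)\<^sup>2) / (4 * \<kappa>) - real a))"
      unfolding e_sum W_def by (simp add: algebra_simps)
    finally show "(norm_L2 1 (\<lambda>t. \<omega> * (model_selection_est \<phi> \<kappa> n ?M y t - S t)))\<^sup>2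
      \<le> (let w = observe (\<lambda>s. - S s) y in
        \<omega>\<^sup>2 * (2 * tail_energy \<phi> S (Suc i) + 2 * K * (real i / real n))
        + 3 * \<omega>\<^sup>2 / real n * (\<Sum>j=1..i. (\<zeta> j w)\<^sup>2)
        + 8 * \<kappa> * \<omega>\<^sup>2 / real n * (\<Sum>a=1..n. exp ((\<Sum>j=1..a. (\<zeta> j w)\<^sup>2) / (4 * \<kappa>) - real a)))"
      by (simp only: Let_def w_def)
  qed
qed

lemma risk_bound:
  assumes S: "S \<in> periodic_L2" "continuous_on UNIV S" and i: "1 \<le> i" "i \<le> n"
  defines "K \<equiv> 4 * \<kappa> * (z_star\<^sup>2 / (z_star - 1))"
  shows "(\<integral>\<^sup>+y. ennreal ((norm_L2 1 (\<lambda>t. \<omega> * (model_selection_est \<phi> \<kappa> n (obs_law S Q) y t - S t)))\<^sup>2) \<partial>obs_law S Q)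
    \<le> ennreal (\<omega>\<^sup>2 * (2 * tail_energy \<phi> S (Suc i) + (2 * K + 3 * \<kappa>) * (real i / real n) + 32 * \<kappa> / real n))"
proof -
  let ?M = "obs_law S Q"
  define G where "G w = \<omega>\<^sup>2 * (2 * tail_energy \<phi> S (Suc i) + 2 * K * (real i / real n))
        + 3 * \<omega>\<^sup>2 / real n * (\<Sum>j=1..i. (\<zeta> j w)\<^sup>2)
        + 8 * \<kappa> * \<omega>\<^sup>2 / real n * (\<Sum>a=1..n. exp ((\<Sum>j=1..a. (\<zeta> j w)\<^sup>2) / (4 * \<kappa>) - real a))" for w
  have K: "0 \<le> K"
    unfolding K_def using kappa_pos penalty_factor_ge by (intro mult_nonneg_nonneg[of "4 * \<kappa>"]) linarith+
  have sets: "sets Q = sets path_space" using path_law by (simp add: path_law_def)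
  have space: "space Q = space path_space" by (rule sets_eq_imp_space_eq[OF sets])
  have S': "continuous_on UNIV (\<lambda>s. - S s)" using S by (intro continuous_intros)
  have "\<zeta> j \<in> borel_measurable path_space" if "j \<ge> 1" for j
    using gaussian_rv_measurable[OF noise_coeff_gaussian[OF that]] sets by (simp cong: measurable_cong_sets)
  then have "G \<in> borel_measurable path_space"
    unfolding G_def[abs_def]
    by (intro borel_measurable_add borel_measurable_times borel_measurable_sum borel_measurable_const
        borel_measurable_exp measurable_compose[OF _ borel_measurable_exp] borel_measurable_diff borel_measurable_divide borel_measurable_power) auto
  from measurable_compose[OF observe_measurable[OF S'] this]
  have Gm: "(\<lambda>y. ennreal (G (observe (\<lambda>s. - S s) y))) \<in> borel_measurable path_space"
    by simp
  have obs: "observe S \<in> Q \<rightarrow>\<^sub>M path_space"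
    using observe_measurable[OF S(2)] sets by (simp cong: measurable_cong_sets)
  have "(\<integral>\<^sup>+y. ennreal ((norm_L2 1 (\<lambda>t. \<omega> * (model_selection_est \<phi> \<kappa> n ?M y t - S t)))\<^sup>2) \<partial>?M)
      \<le> (\<integral>\<^sup>+y. ennreal (G (observe (\<lambda>s. - S s) y)) \<partial>?M)"
  proof (rule nn_integral_mono_AE)
    from loss_bound[OF S i, of \<omega>, folded K_def]
    show "AE y in ?M. ennreal ((norm_L2 1 (\<lambda>t. \<omega> * (model_selection_est \<phi> \<kappa> n ?M y t - S t)))\<^sup>2)
        \<le> ennreal (G (observe (\<lambda>s. - S s) y))"
      unfolding Let_def G_def by eventually_elim (rule ennreal_leI)
  qed
  also have "\<dots> = (\<integral>\<^sup>+w. ennreal (G (observe (\<lambda>s. - S s) (observe S w))) \<partial>Q)"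
    unfolding obs_law_def by (rule nn_integral_distr[OF obs]) (use Gm in simp)
  also have "\<dots> = (\<integral>\<^sup>+w. ennreal (G w) \<partial>Q)"
    by (intro nn_integral_cong) (simp add: observe_uminus_cancel space)
  also have "\<dots> \<le> ennreal (\<omega>\<^sup>2 * (2 * tail_energy \<phi> S (Suc i) + 2 * K * (real i / real n))
      + 3 * \<omega>\<^sup>2 / real n * (real i * \<kappa>) + 8 * \<kappa> * \<omega>\<^sup>2 / real n * 4)"
    unfolding G_def
    by (rule noise_nn_integral_bound) (use K kappa_pos tail_energy_nonneg[OF basis S(1)] in auto)
  also have "\<dots> = ennreal (\<omega>\<^sup>2 * (2 * tail_energy \<phi> S (Suc i) + (2 * K + 3 * \<kappa>) * (real i / real n) + 32 * \<kappa> / real n))"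
    by (rule arg_cong[where f=ennreal]) (simp add: algebra_simps add_divide_distrib)
  finally show ?thesis .
qed

end

section \<open>The uniform rate\<close>

lemma rate_square:
  assumes "n \<ge> 1" "\<beta> > 0"
  shows "(rate n \<beta>)\<^sup>2 = real n powr (2 * \<beta> / (2 * \<beta> + 1))"
  using assms by (simp add: rate_def power2_eq_square powr_add[symmetric] add_divide_distrib[symmetric])

lemma oracle_dimension:
  assumes n: "n \<ge> 1" and \<beta>: "\<beta> > 0"
  obtains i where "1 \<le> i" "i \<le> n" "(rate n \<beta>)\<^sup>2 * (real i / real n) \<le> 1"
    "(rate n \<beta>)\<^sup>2 \<le> real (Suc i) powr (2 * \<beta>)"
proof
  let ?x = "real n powr (1 / (2 * \<beta> + 1))"
  let ?i = "nat \<lfloor>?x\<rfloor>"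
  have x1: "1 \<le> ?x" using n \<beta> by (intro ge_one_powr_ge_zero) auto
  have "?x \<le> real n powr 1" using n \<beta> by (intro powr_mono) auto
  then have xn: "?x \<le> real n" using n by simp
  show "1 \<le> ?i" using x1 by (simp add: le_nat_iff le_floor_iff)
  have ix: "real ?i \<le> ?x" using x1 by simp
  then show "?i \<le> n" using xn by linarith
  have "(rate n \<beta>)\<^sup>2 * (real ?i / real n) \<le> real n powr (2 * \<beta> / (2 * \<beta> + 1)) * (?x / real n)"
    unfolding rate_square[OF assms] using ix by (intro mult_left_mono divide_right_mono) auto
  also have "\<dots> = real n powr (2 * \<beta> / (2 * \<beta> + 1) + 1 / (2 * \<beta> + 1)) / real n"
    by (simp add: powr_add)
  also have "2 * \<beta> / (2 * \<beta> + 1) + 1 / (2 * \<beta> + 1) = 1"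
    using \<beta> by (simp add: add_divide_distrib[symmetric])
  finally show "(rate n \<beta>)\<^sup>2 * (real ?i / real n) \<le> 1" using n by simp
  have "(rate n \<beta>)\<^sup>2 = ?x powr (2 * \<beta>)"
    unfolding rate_square[OF assms] by (simp add: powr_powr)
  also have "\<dots> \<le> real (Suc ?i) powr (2 * \<beta>)"
    using x1 \<beta> by (intro powr_mono2) linarith+
  finally show "(rate n \<beta>)\<^sup>2 \<le> real (Suc ?i) powr (2 * \<beta>)" .
qed

lemma rate_square_le:
  assumes "n \<ge> 1" "\<beta> > 0"
  shows "(rate n \<beta>)\<^sup>2 / real n \<le> 1"
proof -
  have "real n powr (2 * \<beta> / (2 * \<beta> + 1)) \<le> real n powr 1"
    using assms by (intro powr_mono) auto
  then show ?thesis using assms by (simp add: rate_square)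
qed

theorem theorem3:
  fixes \<phi> :: "nat \<Rightarrow> real \<Rightarrow> real" and P :: "(real \<Rightarrow> real) measure set" and r \<kappa> :: real
  assumes "orthonormal_basis \<phi>"
    and "noise_class \<phi> \<kappa> P"
    and "r > 0"
  shows "limsup (\<lambda>n. SUP \<beta>\<in>{0<..}. risk \<phi> r P n (model_selection_est \<phi> \<kappa> n) \<beta>) < \<infinity>"
proof -
  define K where "K = 4 * \<kappa> * (z_star\<^sup>2 / (z_star - 1))"
  define C where "C = 2 * r\<^sup>2 + (2 * K + 3 * \<kappa>) + 32 * \<kappa>"
  have "risk \<phi> r P n (model_selection_est \<phi> \<kappa> n) \<beta> \<le> ennreal C" if n: "n \<ge> 1" and \<beta>: "\<beta> > 0" for n \<beta>
    unfolding risk_def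
  proof (intro SUP_least)
    fix S Q assume S: "S \<in> Theta \<phi> \<beta> r" and Q: "Q \<in> P"
    then have SL: "S \<in> periodic_L2" "continuous_on UNIV S"
      by (auto simp: Theta_def)
    interpret noise \<phi> \<kappa> Q n
      using assms Q n by unfold_locales (auto simp: noise_class_def)
    let ?\<omega> = "rate n \<beta>"
    obtain i where i: "1 \<le> i" "i \<le> n" and i1: "?\<omega>\<^sup>2 * (real i / real n) \<le> 1"
      and i2: "?\<omega>\<^sup>2 \<le> real (Suc i) powr (2 * \<beta>)"
      by (rule oracle_dimension[OF n \<beta>])
    let ?T = "tail_energy \<phi> S (Suc i)"
    have "?\<omega>\<^sup>2 * ?T \<le> real (Suc i) powr (2 * \<beta>) * ?T"
      by (rule mult_right_mono[OF i2 tail_energy_nonneg[OF basis SL(1)]])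
    also have "\<dots> \<le> r\<^sup>2"
      using S by (auto simp: Theta_def simp del: of_nat_Suc)
    finally have tail: "?\<omega>\<^sup>2 * ?T \<le> r\<^sup>2" .
    have K: "0 \<le> K"
      unfolding K_def using kappa_pos penalty_factor_ge by (intro mult_nonneg_nonneg[of "4 * \<kappa>"]) linarith+
    have "?\<omega>\<^sup>2 * (2 * ?T + (2 * K + 3 * \<kappa>) * (real i / real n) + 32 * \<kappa> / real n)
        = 2 * (?\<omega>\<^sup>2 * ?T) + (2 * K + 3 * \<kappa>) * (?\<omega>\<^sup>2 * (real i / real n)) + 32 * \<kappa> * (?\<omega>\<^sup>2 / real n)"
    proof -
      have "w * (2 * t + A * x + B / m) = 2 * (w * t) + A * (w * x) + B * (w / m)" for w t A x B m :: real
        by (simp add: algebra_simps)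
      then show ?thesis .
    qed
    also have "\<dots> \<le> 2 * r\<^sup>2 + (2 * K + 3 * \<kappa>) * 1 + 32 * \<kappa> * 1"
      using tail i1 rate_square_le[OF n \<beta>] K kappa_pos by (intro add_mono mult_left_mono) auto
    also have "\<dots> = C" by (simp add: C_def)
    finally show "(\<integral>\<^sup>+y. ennreal ((norm_L2 1 (\<lambda>t. ?\<omega> * (model_selection_est \<phi> \<kappa> n (obs_law S Q) y t - S t)))\<^sup>2)
        \<partial>obs_law S Q) \<le> ennreal C"
      using risk_bound[OF SL i, of ?\<omega>, folded K_def] by (meson ennreal_leI order_trans)
  qed
  then have "limsup (\<lambda>n. SUP \<beta>\<in>{0<..}. risk \<phi> r P n (model_selection_est \<phi> \<kappa> n) \<beta>) \<le> ennreal C"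
    by (intro Limsup_bounded) (auto simp: eventually_sequentially intro!: exI[of _ 1] SUP_least)
  also have "\<dots> < \<infinity>" by simp
  finally show ?thesis .
qed

end
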